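(* Let $\mathcal{B} \subset \mathcal{P}(5)$ be a family of subsets of $\{1,2,3,4,5\}$ whose largest set has $5$ elements. Then $\mathcal{B}$ is a proper $FC(5)$-family if and only if, up to some permutation of $\{1,2,3,4,5\}$, it is the family generated by one of the following set systems: (a) any three of the $3$-subsets of $\{1,2,3,4,5\}$; (b) $\{1,2,3\}$, $\{1,2,4\}$ and $\{1,3,4,5\}$; (c) $\{1,2,3\}$, $\{1,4,5\}$ and $\{2,3,4,5\}$; (d) $\{1,2,3\}$, $\{1,4,5\}$, $\{1,2,3,4\}$, $\{1,2,3,5\}$, $\{1,2,4,5\}$ and $\{1,3,4,5\}$; (e) $\{1,2,3\}$, $\{1,2,4,5\}$, $\{1,3,4,5\}$ and $\{2,3,4,5\}$; (f) all five $4$-subsets of $\{1,2,3,4,5\}$. In particular, $FC(3,5) = 3$ and $FC(4,5) = 5$.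
   Context: All families of sets are finite families of finite sets. $[n]=\{1,\ldots,n\}$ and $\mathcal{P}(n)$ is the power set of $[n]$. A family $\mathcal{A}$ is union-closed if $A \cup B \in \mathcal{A}$ for all $A,B \in \mathcal{A}$. An $FC(k)$-family is a union-closed family $\mathcal{B}$ containing $\emptyset$ and whose largest set has $k$ elements, such that for every union-closed family $\mathcal{A} \supseteq \mathcal{B}$, one of the $k$ elements of the largest set of $\mathcal{B}$ belongs to at least half of the sets of $\mathcal{A}$. A family is $FC$ if it is $FC(k)$ for some $k$. An $FC(k)$-family is proper if it contains no strictly smaller $FC$-family (as a subfamily). The family generated by a set system $\mathcal{S} \subset \mathcal{P}(n)$ is the smallest union-closed family containing $\mathcal{S} \cup \{\emptyset\}$, i.e. the family of all unions of members of $\mathcal{S}\cup\{\emptyset\}$. An $i$-set (or $i$-subset) is a set with exactly $i$ elements. $FC(k,n)$ denotes the minimal $m$ such that any $m$ (distinct) $k$-subsets of $[n]$ generate an $FC$-family. *)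

theory Defs
  imports Complex_Main "HOL-Library.Ramsey" "HOL-Combinatorics.Permutations"
begin

text \<open>
  Every finite family of finite sets is, up to renaming elements, a family of finite
  sets of natural numbers. Quantifying over the families \<open>A\<close> of finite sets of naturals
  that extend \<open>B\<close> is therefore the same as quantifying over all finite families of
  finite sets that extend \<open>B\<close>; the members of \<open>A\<close> may have elements outside \<open>\<Union>B\<close>.
\<close>

definition set_family :: "nat set set \<Rightarrow> bool" where
  "set_family A \<longleftrightarrow> finite A \<and> (\<forall>X\<in>A. finite X)"

definition union_closed :: "'a set set \<Rightarrow> bool" where
  "union_closed A \<longleftrightarrow> (\<forall>X\<in>A. \<forall>Y\<in>A. X \<union> Y \<in> A)"

definition largest_set :: "'a set set \<Rightarrow> 'a set \<Rightarrow> bool" where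
  "largest_set A L \<longleftrightarrow> is_arg_max card (\<lambda>X. X \<in> A) L"

definition FC :: "nat \<Rightarrow> nat set set \<Rightarrow> bool" where
  "FC k B \<longleftrightarrow>
     set_family B \<and> union_closed B \<and> {} \<in> B \<and>
     (\<exists>L. largest_set B L \<and> card L = k \<and>
        (\<forall>A. set_family A \<and> union_closed A \<and> B \<subseteq> A \<longrightarrow>
           (\<exists>x\<in>L. card A \<le> 2 * card {X \<in> A. x \<in> X})))"

definition FC_family :: "nat set set \<Rightarrow> bool" where
  "FC_family B \<longleftrightarrow> (\<exists>k. FC k B)"

definition proper_FC :: "nat \<Rightarrow> nat set set \<Rightarrow> bool" where
  "proper_FC k B \<longleftrightarrow> FC k B \<and> \<not> (\<exists>C. C \<subset> B \<and> FC_family C)"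

definition generated_family :: "'a set set \<Rightarrow> 'a set set" where
  "generated_family S = union_closed hull (S \<union> {{}})"

text \<open>
  \<open>nsets {1..n} k\<close> is the set of all \<open>k\<close>-subsets of \<open>{1..n}\<close>, hence \<open>S\<close> below is
  automatically finite.
\<close>

definition FC_number :: "nat \<Rightarrow> nat \<Rightarrow> nat" where
  "FC_number k n =
     (LEAST m. \<forall>S. S \<subseteq> nsets {1..n} k \<and> card S = m \<longrightarrow> FC_family (generated_family S))"

end

(*
  Let B have largest set L. Split a union-closed family A containing B by the traces of its members
  outside L; every class F, restricted to L, is union-closed and closed under adding members of B.
  If some nonnegative weights on L give every such F an average weight of at least half the total,
  then some element of L lies in at least half of A (Poonen). For a fixed B this is a linear
  inequality in the indicator function of F, and it follows from a few inequalities
  f X + f Y <= f (X u Y) + f V.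

  Conversely, suppose that suitable multiples of the families F_x = {X u m | X <= L - {x}, m in M}
  contain every element of L in less than half of their members. Glued together along a large set of
  new points they give a union-closed family containing M in which every element of L is rare, so no
  subfamily of M is an FC-family. Up to permutation there are three maximal such M without 1-sets and
  2-sets. A family on five points without 1-sets and 2-sets is contained in one of them or contains
  one of the listed systems, which gives the classification.
*)

theory Submission
  imports Defs
begin

subsection \<open>Weights\<close>

text \<open>Double counting: the sum of \<open>2 * sum c (X \<inter> L) - sum c L\<close> over
  \<open>A\<close> is also the combination of the differences
  \<open>2 * card {X \<in> A. x \<in> X} - card A\<close> with coefficients \<open>c x\<close>.
  Class by class it is nonnegative, whereas it would be negative if every element of
  \<open>L\<close> were rare.\<close>

lemma FC_if_weights:
  fixes c :: "nat \<Rightarrow> int"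
  assumes L: "finite L" "B \<subseteq> Pow L" "L \<in> B" and B: "union_closed B" "{} \<in> B"
    and c: "\<And>x. x \<in> L \<Longrightarrow> 0 \<le> c x" "\<exists>x\<in>L. 0 < c x"
    and weight: "\<And>F. F \<subseteq> Pow L \<Longrightarrow> union_closed F \<Longrightarrow> (\<forall>X\<in>F. \<forall>b\<in>B. X \<union> b \<in> F) \<Longrightarrow>
      0 \<le> (\<Sum>X\<in>F. 2 * sum c X - sum c L)"
  shows "FC (card L) B"
proof -
  have "largest_set B L"
    unfolding largest_set_def is_arg_max_def
    using L(2,3) card_mono[OF L(1)] by (meson PowD not_less subset_iff)
  moreover have "set_family B"
    using L by (auto simp: set_family_def intro: finite_subset)
  moreover have "\<exists>x\<in>L. card A \<le> 2 * card {X \<in> A. x \<in> X}"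
    if A: "set_family A" "union_closed A" "B \<subseteq> A" for A
  proof (rule ccontr)
    assume "\<not> ?thesis"
    then have rare: "2 * card {X \<in> A. x \<in> X} < card A" if "x \<in> L" for x
      using that by force
    have fin: "finite A"
      using A by (simp add: set_family_def)
    define g where "g X = 2 * sum c X - sum c L" for X
    define F where "F Z = (\<lambda>X. X \<inter> L) ` {X \<in> A. X - L = Z}" for Z
    have "0 \<le> (\<Sum>X\<in>F Z. g X)" for Z
      unfolding g_def
    proof (rule weight)
      show "F Z \<subseteq> Pow L"
        by (auto simp: F_def)
      \<comment> \<open>The condition is \<open>Y - L \<subseteq> Z\<close> rather than equality, so
        that the same fact covers \<open>Y = b\<close> with \<open>b \<in> B\<close>, which has no
        points outside \<open>L\<close>.\<close>
      have "X \<inter> L \<union> Y \<inter> L \<in> F Z" if "X \<in> A" "Y \<in> A" "X - L = Z" "Y - L \<subseteq> Z" for X Y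
        unfolding F_def by (rule image_eqI[of _ _ "X \<union> Y"])
          (use that A(2) in \<open>auto simp: union_closed_def\<close>)
      note * = this
      show "union_closed (F Z)"
        unfolding union_closed_def using * by (auto simp: F_def)
      have "X \<inter> L \<union> b \<in> F Z" if "X \<in> A" "X - L = Z" "b \<in> B" for X b
      proof -
        have "b \<in> A" "b \<subseteq> L"
          using that A(3) L(2) by auto
        then show ?thesis
          using *[of X b] that by (simp add: Int_absorb2 Diff_eq_empty_iff[THEN iffD2])
      qed
      then show "\<forall>X\<in>F Z. \<forall>b\<in>B. X \<union> b \<in> F Z"
        by (auto simp: F_def)
    qed
    \<comment> \<open>Within a class the part outside \<open>L\<close> is fixed, so taking traces is
      injective there.\<close>
    moreover have "(\<Sum>X\<in>F Z. g X) = (\<Sum>X | X \<in> A \<and> X - L = Z. g (X \<inter> L))" for Z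
      unfolding F_def by (subst sum.reindex) (auto simp: inj_on_def)
    ultimately have "0 \<le> (\<Sum>X | X \<in> A \<and> X - L = Z. g (X \<inter> L))" for Z
      by simp
    then have "0 \<le> (\<Sum>X\<in>A. g (X \<inter> L))"
      by (subst sum.image_gen[OF fin, of _ "\<lambda>X. X - L"]) (rule sum_nonneg)
    also have "(\<Sum>X\<in>A. g (X \<inter> L)) = 2 * (\<Sum>X\<in>A. \<Sum>x\<in>L. c x * of_bool (x \<in> X)) - card A * sum c L"
    proof -
      have "sum c (X \<inter> L) = (\<Sum>x\<in>L. c x * of_bool (x \<in> X))" for X
        using L(1) by (simp add: Int_commute)
      then show ?thesis
        by (simp add: g_def sum_subtractf flip: sum_distrib_left)
    qed
    also have "\<dots> = (\<Sum>x\<in>L. c x * (2 * int (card {X \<in> A. x \<in> X}) - int (card A)))"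
    proof -
      have "(\<Sum>X\<in>A. of_bool (x \<in> X)) = int (card {X \<in> A. x \<in> X})" for x
        using fin by (simp add: Int_def)
      then have "(\<Sum>X\<in>A. \<Sum>x\<in>L. c x * of_bool (x \<in> X)) = (\<Sum>x\<in>L. c x * card {X \<in> A. x \<in> X})"
        by (subst sum.swap) (simp flip: sum_distrib_left)
      then show ?thesis
        by (simp add: sum_distrib_left sum_distrib_right right_diff_distrib sum_subtractf ac_simps)
    qed
    also have "\<dots> < (\<Sum>x\<in>L. 0)"
    proof (rule sum_strict_mono_ex1[OF L(1)])
      have neg: "2 * int (card {X \<in> A. x \<in> X}) - int (card A) < 0" if "x \<in> L" for x
        using rare[OF that] by linarith
      show "\<forall>x\<in>L. c x * (2 * int (card {X \<in> A. x \<in> X}) - int (card A)) \<le> 0"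
        using neg c(1) by (meson less_imp_le mult_nonneg_nonpos)
      show "\<exists>x\<in>L. c x * (2 * int (card {X \<in> A. x \<in> X}) - int (card A)) < 0"
        using neg c(2) by (meson mult_pos_neg)
    qed
    finally show False
      by simp
  qed
  ultimately show ?thesis
    using B unfolding FC_def by blast
qed

text \<open>
  With \<open>f\<close> the indicator function of \<open>F\<close>, an entry \<open>(l, X, Y, V)\<close> of \<open>cs\<close> stands for \<open>l\<close> times the
  inequality \<open>f X + f Y \<le> f (X \<union> Y) + f V\<close>, which holds because \<open>V\<close> arises both from \<open>X\<close> and from \<open>Y\<close>
  by adding a member of \<open>B\<close>. For \<open>X = Y\<close> it reads \<open>f X \<le> f V\<close>.
\<close>

lemma FC_certificate:
  fixes c :: "nat \<Rightarrow> int" and cs :: "(int \<times> nat set \<times> nat set \<times> nat set) list"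
  assumes L: "finite L" "B \<subseteq> Pow L" "L \<in> B" and B: "union_closed B" "{} \<in> B"
    and c: "\<forall>x\<in>L. 0 \<le> c x" "\<exists>x\<in>L. 0 < c x"
    and valid: "\<forall>(l, X, Y, V)\<in>set cs. 0 \<le> l \<and> X \<subseteq> V \<and> Y \<subseteq> V \<and>
      (\<exists>b\<in>B. b \<subseteq> V \<and> V \<subseteq> X \<union> b) \<and> (\<exists>b\<in>B. b \<subseteq> V \<and> V \<subseteq> Y \<union> b)"
    and weight: "\<forall>Z\<in>Pow L. (\<Sum>(l, X, Y, V)\<leftarrow>cs.
        l * (of_bool (Z = X \<union> Y) + of_bool (Z = V) - of_bool (Z = X) - of_bool (Z = Y)))
      \<le> 2 * sum c Z - sum c L"
  shows "FC (card L) B"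
proof (rule FC_if_weights[OF L B])
  fix F
  assume F: "F \<subseteq> Pow L" "union_closed F" "\<forall>X\<in>F. \<forall>b\<in>B. X \<union> b \<in> F"
  then have fin: "finite F"
    using L(1) by (meson finite_Pow_iff finite_subset)
  let ?h = "\<lambda>Z (l, X, Y, V).
    l * (of_bool (Z = X \<union> Y) + of_bool (Z = V) - of_bool (Z = X) - of_bool (Z = Y)) :: int"
  \<comment> \<open>Summing a coefficient over \<open>F\<close> turns it into a value of the
    indicator function of \<open>F\<close>.\<close>
  have delta: "(\<Sum>Z\<in>F. of_bool (Z = X)) = (of_bool (X \<in> F) :: int)" for X
    using fin by (simp add: of_bool_def)
  have "0 \<le> (\<Sum>Z\<in>F. ?h Z q)" if "q \<in> set cs" for q
  proof -
    obtain l X Y V where q: "q = (l, X, Y, V)"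
      by (cases q)
    have "case q of (l, X, Y, V) \<Rightarrow> 0 \<le> l \<and> X \<subseteq> V \<and> Y \<subseteq> V \<and>
      (\<exists>b\<in>B. b \<subseteq> V \<and> V \<subseteq> X \<union> b) \<and> (\<exists>b\<in>B. b \<subseteq> V \<and> V \<subseteq> Y \<union> b)"
      using valid that by (rule bspec)
    then have l: "0 \<le> l" and "X \<subseteq> V" "Y \<subseteq> V"
      and ex: "\<exists>b\<in>B. b \<subseteq> V \<and> V \<subseteq> X \<union> b" "\<exists>b\<in>B. b \<subseteq> V \<and> V \<subseteq> Y \<union> b"
      by (simp_all add: q)
    then obtain b b' where "b \<in> B" "b' \<in> B" and V: "V = X \<union> b" "V = Y \<union> b'"
      by (metis Un_least subset_antisym)
    then have "X \<in> F \<Longrightarrow> V \<in> F" "Y \<in> F \<Longrightarrow> V \<in> F" "X \<in> F \<Longrightarrow> Y \<in> F \<Longrightarrow> X \<union> Y \<in> F"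
      using F(2,3) unfolding union_closed_def by metis+
    then have "0 \<le> of_bool (X \<union> Y \<in> F) + of_bool (V \<in> F) - of_bool (X \<in> F) - (of_bool (Y \<in> F) :: int)"
      by auto
    then show ?thesis
      using l by (simp add: q sum.distrib sum_subtractf delta flip: sum_distrib_left)
  qed
  then have "0 \<le> (\<Sum>q\<leftarrow>cs. \<Sum>Z\<in>F. ?h Z q)"
    by (induction cs) auto
  also have "\<dots> = (\<Sum>Z\<in>F. \<Sum>q\<leftarrow>cs. ?h Z q)"
    by (induction cs) (auto simp: sum.distrib)
  also have "\<dots> \<le> (\<Sum>Z\<in>F. 2 * sum c Z - sum c L)"
    using weight F(1) by (intro sum_mono) blast
  finally show "0 \<le> (\<Sum>Z\<in>F. 2 * sum c Z - sum c L)" .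
qed (use c in auto)

subsection \<open>Counterexamples from local families\<close>

text \<open>Ranging over all subfamilies makes the property hereditary, so that properness can be
  tested against a few maximal \<open>M\<close>.\<close>

definition non_FC :: "nat set set \<Rightarrow> bool" where
  "non_FC B \<longleftrightarrow> (\<forall>C\<subseteq>B. \<not> FC_family C)"

lemma non_FC_subset: "non_FC M \<Longrightarrow> B \<subseteq> M \<Longrightarrow> non_FC B"
  unfolding non_FC_def by blast

text \<open>Signed, so that it is additive over disjoint unions; \<open>z\<close> lies in at least
  half of a finite \<open>A\<close> exactly when it is nonnegative.\<close>

definition balance :: "'a set set \<Rightarrow> 'a \<Rightarrow> int" where
  "balance A z = (\<Sum>X\<in>A. if z \<in> X then 1 else - 1)"

lemma balance_eq_card:
  assumes "finite A"
  shows "balance A z = 2 * int (card {X \<in> A. z \<in> X}) - int (card A)"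
proof -
  have "balance A z = (\<Sum>X\<in>A. 2 * of_bool (z \<in> X) - 1)"
    by (auto simp: balance_def intro!: sum.cong)
  also have "\<dots> = 2 * int (card {X \<in> A. z \<in> X}) - int (card A)"
    using assms by (simp add: sum_subtractf Int_def flip: sum_distrib_left)
  finally show ?thesis .
qed

lemma balance_Un_disjoint:
  "finite A \<Longrightarrow> finite B \<Longrightarrow> A \<inter> B = {} \<Longrightarrow> balance (A \<union> B) z = balance A z + balance B z"
  by (simp add: balance_def sum.union_disjoint)

lemma balance_image_Un:
  assumes "\<And>X. X \<in> A \<Longrightarrow> X \<inter> W = {}" "z \<notin> W"
  shows "balance ((\<lambda>X. X \<union> W) ` A) z = balance A z"
proof -
  have "inj_on (\<lambda>X. X \<union> W) A"
    using assms(1) by (intro inj_onI) blast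
  then show ?thesis
    using assms(2) by (simp add: balance_def sum.reindex)
qed

lemma balance_Pow:
  assumes "finite L" "z \<in> L"
  shows "balance (Pow L) z = 0"
proof -
  have L: "L = insert z (L - {z})"
    using assms by blast
  have "balance (Pow L) z = balance (Pow (L - {z})) z + balance (insert z ` Pow (L - {z})) z"
    by (subst L, subst Pow_insert, rule balance_Un_disjoint) (use assms in auto)
  also have "balance (insert z ` Pow (L - {z})) z = (\<Sum>X\<in>Pow (L - {z}). 1)"
    unfolding balance_def by (subst sum.reindex) (auto simp: inj_on_def)
  also have "balance (Pow (L - {z})) z = (\<Sum>X\<in>Pow (L - {z}). - 1)"
    unfolding balance_def by (rule sum.cong) auto
  finally show ?thesis
    by simp
qed

text \<open>The family of all \<open>X \<union> m\<close> with \<open>X \<subseteq> L - {x}\<close> and \<open>m \<in> M\<close>, provided that \<open>{} \<in> M\<close>.\<close>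

definition join_avoiding :: "'a set \<Rightarrow> 'a set set \<Rightarrow> 'a \<Rightarrow> 'a set set" where
  "join_avoiding L M x = {Z \<in> Pow L. x \<notin> Z \<or> (\<exists>m\<in>M. x \<in> m \<and> m \<subseteq> Z)}"

text \<open>For \<open>x \<in> L\<close>, \<open>join_avoiding L M x\<close> has balance at most 0
  at \<open>x\<close> and at least 0 at the other points of \<open>L\<close>; the multiplicities
  \<open>\<mu>\<close> have to make one combination negative everywhere. The same \<open>A\<close>
  then serves every \<open>C \<subseteq> M\<close>, whose largest set lies inside
  \<open>L\<close>.\<close>

lemma non_FC_if_balance_neg:
  fixes L :: "nat set"
  assumes L: "finite L" "M \<subseteq> Pow L" and M: "union_closed M"
    and neg: "\<forall>z\<in>L. (\<Sum>x\<in>L. int (\<mu> x) * balance (join_avoiding L M x) z) < 0"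
  shows "non_FC M"
  unfolding non_FC_def
proof (intro allI impI notI)
  fix C
  assume C: "C \<subseteq> M" and "FC_family C"
  then obtain D where D: "D \<in> C"
    and FC: "\<And>A. set_family A \<Longrightarrow> union_closed A \<Longrightarrow> C \<subseteq> A \<Longrightarrow>
      \<exists>x\<in>D. card A \<le> 2 * card {X \<in> A. x \<in> X}"
    unfolding FC_family_def FC_def largest_set_def is_arg_max_def by blast
  define F where "F = join_avoiding L M"
  \<comment> \<open>\<open>A\<close> consists of \<open>M\<close>, of all \<open>X \<union> Y\<close> with \<open>X \<subseteq> L\<close>, and, for each new point \<open>y \<in> Y\<close> labelled by
    some \<open>x \<in> L\<close>, of all \<open>X \<union> (Y - {y})\<close> with \<open>X \<in> F x\<close>. Members with different \<open>y\<close> have a union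
    containing \<open>Y\<close>. There are \<open>K * \<mu> x\<close> points with label \<open>x\<close>, and \<open>K\<close> is large enough to
    outweigh \<open>M\<close>.\<close>
  define K where "K = card M + 2"
  \<comment> \<open>\<open>b\<close> exceeds every element of \<open>L\<close>, so all points
    \<open>e q\<close> are new.\<close>
  define b where "b = Suc (Max (insert 0 L))"
  define J where "J = Sigma L (\<lambda>x. {..<K * \<mu> x})"
  define e where "e q = b + prod_encode q" for q :: "nat \<times> nat"
  define Y where "Y = e ` J"
  have finM: "finite M"
    using L by (meson finite_Pow_iff finite_subset)
  have finJ: "finite J"
    using L by (simp add: J_def)
  have inj_e: "inj e"
    by (auto simp: e_def inj_def dest: prod_encode_eq[THEN iffD1])
  have "y < b" if "y \<in> L" for y
    using L(1) that by (simp add: b_def less_Suc_eq_le)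
  then have YL: "Y \<inter> L = {}"
    by (fastforce simp: Y_def e_def)
  have finY: "finite Y"
    using finJ by (simp add: Y_def)
  \<comment> \<open>A witness \<open>m\<close> for one set remains a witness for every larger set,
    and an added \<open>m\<close> containing \<open>x\<close> is its own witness.\<close>
  have F: "F x \<subseteq> Pow L" "union_closed (F x)" "Z \<in> F x \<Longrightarrow> m \<in> M \<Longrightarrow> Z \<union> m \<in> F x" for x Z m
    using L(2) unfolding F_def join_avoiding_def union_closed_def by blast+
  define G where "G q = (\<lambda>X. X \<union> (Y - {e q})) ` F (fst q)" for q
  define A where "A = M \<union> ((\<Union>q\<in>J. G q) \<union> (\<lambda>X. X \<union> Y) ` Pow L)"
  have finG: "finite (G q)" for q
    unfolding G_def by (rule finite_imageI, rule finite_subset[OF F(1)]) (simp add: L(1))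
  have G_neq: "X \<noteq> X'" if "X \<in> G q" "X' \<in> G q'" "q \<in> J" "q' \<in> J" "q \<noteq> q'" for X X' q q'
  proof -
    have "e q \<in> Y" "e q \<noteq> e q'"
      using that(3,5) by (simp_all add: Y_def inj_eq[OF inj_e])
    moreover from this have "e q \<notin> L"
      using YL by blast
    ultimately have "e q \<notin> X" "e q \<in> X'"
      using that(1,2) F(1)[of "fst q"] by (auto simp: G_def)
    then show ?thesis
      by blast
  qed
  have A_sub: "X \<subseteq> L \<union> Y" if "X \<in> A" for X
    using that L(2) F(1) by (auto simp: A_def G_def)
  then have "A \<subseteq> Pow (L \<union> Y)"
    by blast
  then have "set_family A"
    unfolding set_family_def using A_sub L(1) finY by (meson finite_Pow_iff finite_UnI finite_subset)
  have Un_top: "X \<union> X' \<in> A" if "X \<subseteq> L \<union> Y" "X' \<subseteq> L \<union> Y" "Y \<subseteq> X \<union> X'" for X X'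
  proof -
    have "X \<union> X' = (X \<union> X') \<inter> L \<union> Y"
      using that by blast
    then show ?thesis
      unfolding A_def by (intro UnI2 image_eqI[of _ _ "(X \<union> X') \<inter> L"]) auto
  qed
  have Un_M: "X \<union> m \<in> A" if "X \<in> A" "m \<in> M" for X m
  proof -
    consider "X \<in> M" | q where "q \<in> J" "X \<in> G q" | "Y \<subseteq> X" "X \<subseteq> L \<union> Y"
      using \<open>X \<in> A\<close> unfolding A_def by auto
    then show ?thesis
    proof cases
      case 1
      then show ?thesis
        using M that by (simp add: A_def union_closed_def)
    next
      case 2
      then obtain Z where Z: "Z \<in> F (fst q)" "X = Z \<union> (Y - {e q})"
        by (auto simp: G_def)
      then have "X \<union> m = (Z \<union> m) \<union> (Y - {e q})"
        by blast
      then have "X \<union> m \<in> G q"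
        unfolding G_def using F(3)[OF Z(1) that(2)] by blast
      then show ?thesis
        using 2 by (auto simp: A_def)
    next
      case 3
      then show ?thesis
        using that L(2) by (intro Un_top) auto
    qed
  qed
  have "union_closed A"
    unfolding union_closed_def
  proof (intro ballI)
    fix X X'
    assume X: "X \<in> A" and X': "X' \<in> A"
    have sub: "X \<subseteq> L \<union> Y" "X' \<subseteq> L \<union> Y"
      using X X' A_sub by blast+
    show "X \<union> X' \<in> A"
    proof (cases "X \<in> M \<or> X' \<in> M")
      case True
      then show ?thesis
        using Un_M X X' by (metis Un_commute)
    next
      case False
      then have *: "(\<exists>q\<in>J. X \<in> G q) \<or> Y \<subseteq> X" "(\<exists>q\<in>J. X' \<in> G q) \<or> Y \<subseteq> X'"
        using X X' by (auto simp: A_def)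
      show ?thesis
      proof (cases "Y \<subseteq> X \<union> X'")
        case True
        then show ?thesis
          using Un_top sub by blast
      next
        case False
        then obtain q q' where q: "q \<in> J" "X \<in> G q" "q' \<in> J" "X' \<in> G q'"
          using * by blast
        then obtain Z Z' where Z: "Z \<in> F (fst q)" "X = Z \<union> (Y - {e q})"
          "Z' \<in> F (fst q')" "X' = Z' \<union> (Y - {e q'})"
          by (auto simp: G_def)
        \<comment> \<open>Two different missing points would make the union contain all of
          \<open>Y\<close>.\<close>
        then have "e q = e q'"
          using False by blast
        then have "q = q'"
          by (simp add: inj_eq[OF inj_e])
        then have "X \<union> X' = (Z \<union> Z') \<union> (Y - {e q})" "Z \<union> Z' \<in> F (fst q)"
          using Z F(2)[of "fst q"] unfolding union_closed_def by blast+
        then have "X \<union> X' \<in> G q"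
          unfolding G_def by blast
        then show ?thesis
          using q(1) unfolding A_def by blast
      qed
    qed
  qed
  moreover have "C \<subseteq> A"
    using C by (auto simp: A_def)
  ultimately obtain z where z: "z \<in> D" "card A \<le> 2 * card {X \<in> A. z \<in> X}"
    using FC \<open>set_family A\<close> by blast
  then have zL: "z \<in> L"
    using D C L(2) by auto
  have finA: "finite A"
    using \<open>set_family A\<close> by (simp add: set_family_def)
  have "0 \<le> balance A z"
    using z(2) by (simp add: balance_eq_card[OF finA])
  define s where "s = (\<Sum>x\<in>L. int (\<mu> x) * balance (F x) z)"
  have "s < 0"
    using neg zL by (simp add: s_def F_def)
  have "s = 0" if "\<forall>x\<in>L. \<mu> x = 0"
    using that by (simp add: s_def)
  then obtain x0 where "x0 \<in> L" "0 < \<mu> x0"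
    using \<open>s < 0\<close> by force
  \<comment> \<open>The \<open>+ 2\<close> in \<open>K\<close> guarantees two points with label
    \<open>x0\<close>. Hence every \<open>Y - {e q}\<close> is nonempty, which keeps the glued
    members apart from those of \<open>M\<close>.\<close>
  then have x0: "(x0, 0) \<in> J" "(x0, 1) \<in> J"
    by (auto simp: J_def K_def)
  have Y2: "\<exists>y\<in>Y. y \<noteq> y'" for y'
  proof -
    have "e (x0, 0) \<in> Y" "e (x0, 1) \<in> Y" "e (x0, 0) \<noteq> e (x0, 1)"
      using x0 by (simp_all add: Y_def inj_eq[OF inj_e])
    then show ?thesis
      by metis
  qed
  have balG: "balance (G q) z = balance (F (fst q)) z" for q
    unfolding G_def
  proof (rule balance_image_Un)
    show "X \<inter> (Y - {e q}) = {}" if "X \<in> F (fst q)" for X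
      using that F(1)[of "fst q"] YL by blast
  qed (use YL zL in blast)
  have "balance (\<Union>q\<in>J. G q) z = (\<Sum>q\<in>J. balance (G q) z)"
    unfolding balance_def
    by (rule sum.UNION_disjoint[OF finJ]) (use finG G_neq in blast)+
  also have "\<dots> = (\<Sum>(x, j)\<in>J. balance (F x) z)"
    by (simp add: balG case_prod_unfold)
  also have "\<dots> = (\<Sum>x\<in>L. \<Sum>j<K * \<mu> x. balance (F x) z)"
    unfolding J_def using L(1) by (intro sum.Sigma[symmetric]) auto
  also have "\<dots> = int K * s"
    by (simp add: s_def sum_distrib_left mult.assoc)
  finally have "balance (\<Union>q\<in>J. G q) z = int K * s" .
  moreover have "balance ((\<lambda>X. X \<union> Y) ` Pow L) z = 0"
    using balance_image_Un[of "Pow L" Y z] balance_Pow[OF L(1) zL] YL zL by auto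
  moreover have "balance M z \<le> card M"
    unfolding balance_def using sum_bounded_above[of M "\<lambda>X. if z \<in> X then 1 else - 1 :: int" 1] by auto
  moreover have "(\<Union>q\<in>J. G q) \<inter> (\<lambda>X. X \<union> Y) ` Pow L = {}"
  proof -
    have "e q \<notin> X" "e q \<in> Y" if "q \<in> J" "X \<in> G q" for q X
    proof -
      show "e q \<in> Y"
        using that(1) by (simp add: Y_def)
      then show "e q \<notin> X"
        using that(2) F(1)[of "fst q"] YL by (auto simp: G_def)
    qed
    then show ?thesis
      by blast
  qed
  moreover have "M \<inter> ((\<Union>q\<in>J. G q) \<union> (\<lambda>X. X \<union> Y) ` Pow L) = {}"
  proof -
    have "\<exists>y\<in>Y. y \<in> X" if X: "X \<in> (\<Union>q\<in>J. G q) \<union> (\<lambda>X. X \<union> Y) ` Pow L" for X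
    proof -
      consider q where "X \<in> G q" | "Y \<subseteq> X"
        using X by blast
      then show ?thesis
      proof cases
        case 1
        then show ?thesis
          using Y2[of "e q"] by (auto simp: G_def)
      next
        case 2
        then show ?thesis
          using Y2 by blast
      qed
    qed
    moreover have "\<not> (\<exists>y\<in>Y. y \<in> X)" if "X \<in> M" for X
      using that L(2) YL by blast
    ultimately show ?thesis
      by blast
  qed
  ultimately have "balance A z \<le> int (card M) + int K * s"
    unfolding A_def using finM finJ finG L(1) by (simp add: balance_Un_disjoint)
  also have "\<dots> \<le> int (card M) - int K"
    using mult_left_mono[of s "- 1" "int K"] \<open>s < 0\<close> by simp
  also have "\<dots> < 0"
    by (simp add: K_def)
  finally show False
    using \<open>0 \<le> balance A z\<close> by simp
qed

section \<open>Evaluation of balances on explicit sets\<close>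

lemma sum_Pow_insert:
  assumes "finite A" "x \<notin> A"
  shows "(\<Sum>Z\<in>Pow (insert x A). g Z) = (\<Sum>Z\<in>Pow A. g Z + g (insert x Z) :: int)"
proof -
  have "inj_on (insert x) (Pow A)"
    using assms(2) by (auto simp: inj_on_def)
  moreover have "Pow A \<inter> insert x ` Pow A = {}"
    using assms(2) by auto
  ultimately show ?thesis
    using assms(1) by (simp add: Pow_insert sum.union_disjoint sum.reindex sum.distrib)
qed

lemma balance_join_avoiding:
  assumes "finite L"
  shows "balance (join_avoiding L M x) z = (\<Sum>Z\<in>Pow L.
    if x \<notin> Z \<or> (\<exists>m\<in>M. x \<in> m \<and> m \<subseteq> Z) then if z \<in> Z then 1 else - 1 else 0)"
  unfolding balance_def join_avoiding_def by (rule sum.inter_filter) (use assms in simp)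

subsection \<open>Certificates on five points\<close>

lemma ball_Pow_insert:
  "(\<forall>Z\<in>Pow (insert x A). P Z) \<longleftrightarrow> (\<forall>Z\<in>Pow A. P Z \<and> P (insert x Z))"
  by (auto simp: Pow_insert)

text \<open>As a rewrite rule it decides equality of explicit sets by membership tests, whatever the
  order of their elements.\<close>

lemma insert_eq_iff_subset: "insert x A = B \<longleftrightarrow> x \<in> B \<and> A \<subseteq> B \<and> B \<subseteq> insert x A"
  by auto

lemmas certificate_simps = union_closed_def ball_Pow_insert insert_eq_iff_subset

lemma distinct_five_neqs:
  assumes "distinct [a, b, c, d, e]"
  shows "a \<noteq> b" "a \<noteq> c" "a \<noteq> d" "a \<noteq> e" "b \<noteq> c" "b \<noteq> d" "b \<noteq> e" "c \<noteq> d" "c \<noteq> e" "d \<noteq> e"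
    "b \<noteq> a" "c \<noteq> a" "d \<noteq> a" "e \<noteq> a" "c \<noteq> b" "d \<noteq> b" "e \<noteq> b" "d \<noteq> c" "e \<noteq> c" "e \<noteq> d"
  using assms by auto

context
  fixes a b c d e :: nat
  assumes distinct: "distinct [a, b, c, d, e]"
begin

lemmas neqs = distinct_five_neqs[OF distinct]

text \<open>
  The weights and the certificates below, and the multiplicities \<open>\<mu>\<close> of the counterexamples, are
  solutions of linear programs. Three 3-subsets of a 5-set are complements of the edges of a graph
  with three edges on five vertices: a triangle, a star, a path, or a path of length two together
  with a disjoint edge.
\<close>

lemma FC_triangle:
  "FC 5 {{}, {a, b, c}, {a, b, d}, {a, b, e}, {a, b, c, d}, {a, b, c, e}, {a, b, d, e},
    {a, b, c, d, e}}" (is "FC 5 ?B")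
proof -
  have "FC (card {a, b, c, d, e}) ?B"
    by (rule FC_certificate[where c = "\<lambda>x. 3 * of_bool (x = a) + 3 * of_bool (x = b) + 2 * of_bool (x = c) +
        2 * of_bool (x = d) + 2 * of_bool (x = e)" and cs = "[
        (4, {}, {}, {a, b, c}), (4, {}, {}, {a, b, d}), (2, {}, {}, {a, b, e}),
        (2, {}, {}, {a, b, d, e}), (2, {a}, {d}, {a, b, c, d}), (2, {a}, {c, d}, {a, b, c, d}),
        (2, {a}, {c, e}, {a, b, c, e}), (4, {b}, {c}, {a, b, c, e}), (2, {b}, {e}, {a, b, e}),
        (2, {c}, {b, d}, {a, b, c, d}), (2, {c}, {b, e}, {a, b, c, e}),
        (2, {a, c}, {d}, {a, b, c, d}), (6, {b, c}, {d, e}, {a, b, c, d, e}),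
        (2, {d}, {e}, {a, b, d, e}), (2, {d}, {b, e}, {a, b, d, e}),
        (2, {a, d}, {e}, {a, b, d, e}), (2, {a, d}, {c, e}, {a, b, c, d, e}),
        (2, {c, d}, {a, e}, {a, b, c, d, e}), (2, {a, c, d}, {e}, {a, b, c, d, e})]"])
      (simp_all add: certificate_simps neqs)
  then show ?thesis
    by (simp add: numeral_eq_Suc neqs)
qed

text \<open>The complements \<open>{d, e}\<close>, \<open>{c, e}\<close>, \<open>{b, e}\<close> form
  a star with centre \<open>e\<close>; as \<open>e\<close> occurs in no 3-set, the family lives on
  four points.\<close>

lemma FC_star:
  "FC 4 {{}, {a, b, c}, {a, b, d}, {a, c, d}, {a, b, c, d}}" (is "FC 4 ?B")
proof -
  have "FC (card {a, b, c, d}) ?B"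
    by (rule FC_certificate[where c = "\<lambda>x. of_bool (x = a) + of_bool (x = b) + of_bool (x = c) +
        of_bool (x = d)" and cs = "[
        (4, {}, {}, {a, b, c}), (2, {a}, {a}, {a, c, d}),
        (2, {a, b, c}, {a, b, c}, {a, b, c, d}), (2, {b}, {d}, {a, b, d}),
        (2, {c}, {b, d}, {a, b, c, d})]"])
      (simp_all add: certificate_simps neqs)
  then show ?thesis
    by (simp add: numeral_eq_Suc neqs)
qed

text \<open>The complements \<open>{d, e}\<close>, \<open>{e, c}\<close>, \<open>{c, b}\<close> form
  a path. The weights respect the symmetry exchanging \<open>b\<close> with \<open>d\<close> and
  \<open>c\<close> with \<open>e\<close>.\<close>

lemma FC_path:
  "FC 5 {{}, {a, b, c}, {a, b, d}, {a, d, e}, {a, b, c, d}, {a, b, d, e}, {a, b, c, d, e}}" (is "FC 5 ?B")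
proof -
  have "FC (card {a, b, c, d, e}) ?B"
    by (rule FC_certificate[where c = "\<lambda>x. 4 * of_bool (x = a) + 3 * of_bool (x = b) + 2 * of_bool (x = c) +
        3 * of_bool (x = d) + 2 * of_bool (x = e)" and cs = "[
        (4, {}, {}, {a, b, c}), (4, {}, {}, {a, b, d, e}), (4, {}, {}, {a, d, e}),
        (2, {}, {}, {a, b, d}), (6, {e}, {e}, {a, b, c, e}), (4, {c, e}, {c, e}, {a, c, d, e}),
        (4, {a}, {b}, {a, b, d}), (2, {a}, {c}, {a, b, c, d}), (4, {b}, {c, d}, {a, b, c, d, e}),
        (4, {a, b}, {e}, {a, b, d, e}), (8, {c}, {d}, {a, b, c, d}),
        (4, {a, c}, {c, d}, {a, c, d, e}), (4, {b, c}, {c, d}, {a, b, c, d, e}),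
        (2, {b, d}, {b, e}, {a, b, d, e}), (2, {b, c, d}, {b, e}, {a, b, c, d, e}),
        (4, {b, c, d}, {d, e}, {a, b, c, d, e}), (2, {a, e}, {c, e}, {a, b, c, e})]"])
      (simp_all add: certificate_simps neqs)
  then show ?thesis
    by (simp add: numeral_eq_Suc neqs)
qed

text \<open>The complements are the path \<open>{d, e}\<close>, \<open>{e, c}\<close> and the
  disjoint edge \<open>{a, b}\<close>.\<close>

lemma FC_path_edge:
  "FC 5 {{}, {a, b, c}, {a, b, d}, {c, d, e}, {a, b, c, d}, {a, b, c, d, e}}" (is "FC 5 ?B")
proof -
  have "FC (card {a, b, c, d, e}) ?B"
    by (rule FC_certificate[where c = "\<lambda>x. 2 * of_bool (x = a) + 2 * of_bool (x = b) + 2 * of_bool (x = c) +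
        2 * of_bool (x = d) + of_bool (x = e)" and cs = "[
        (4, {}, {}, {a, b, c}), (4, {}, {}, {a, b, d}), (1, {}, {}, {c, d, e}),
        (2, {a}, {a}, {a, c, d, e}), (1, {b}, {b}, {b, c, d, e}), (2, {c}, {c}, {a, b, c, d}),
        (1, {a, b, c}, {a, b, c}, {a, b, c, d}), (1, {d}, {d}, {a, b, c, d, e}),
        (1, {a, b, d}, {a, b, d}, {a, b, c, d, e}), (2, {e}, {e}, {a, b, c, e}),
        (4, {e}, {e}, {a, b, d, e}), (1, {b, e}, {b, e}, {b, c, d, e}),
        (1, {a, c, e}, {a, c, e}, {a, c, d, e}), (2, {d, e}, {d, e}, {a, b, d, e}),
        (2, {a, b, d, e}, {a, b, d, e}, {a, b, c, d, e}), (1, {a}, {c}, {a, b, c, d}),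
        (1, {a}, {d}, {a, b, c, d, e}), (1, {a}, {c, d}, {a, b, c, d}),
        (2, {b}, {c}, {a, b, c, d}), (2, {b}, {d}, {a, b, c, d, e}),
        (1, {a, b}, {e}, {a, b, c, d, e}), (2, {a, c}, {a, d}, {a, c, d, e}),
        (3, {b, c}, {b, d}, {b, c, d, e}), (1, {d}, {b, e}, {a, b, c, d, e}),
        (2, {a, e}, {c, e}, {a, b, c, e}), (1, {a, e}, {d, e}, {a, b, d, e}),
        (1, {b, e}, {c, e}, {a, b, c, e})]"])
      (simp_all add: certificate_simps neqs)
  then show ?thesis
    by (simp add: numeral_eq_Suc neqs)
qed

lemma FC_b:
  "FC 5 {{}, {a, b, c}, {a, b, d}, {a, b, c, d}, {a, c, d, e}, {a, b, c, d, e}}" (is "FC 5 ?B")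
proof -
  have "FC (card {a, b, c, d, e}) ?B"
    by (rule FC_certificate[where c = "\<lambda>x. 8 * of_bool (x = a) + 7 * of_bool (x = b) + 6 * of_bool (x = c) +
        6 * of_bool (x = d) + 2 * of_bool (x = e)" and cs = "[
        (21, {}, {}, {a, b, c}), (8, {}, {}, {a, b, d}), (2, {b}, {b}, {a, b, d}),
        (15, {a, b, c}, {a, b, c}, {a, b, c, d}), (2, {c, d}, {c, d}, {a, c, d, e}),
        (5, {e}, {e}, {a, b, c, e}), (12, {e}, {e}, {a, b, d, e}),
        (3, {e}, {e}, {a, b, c, d, e}), (1, {a, e}, {a, e}, {a, b, c, e}),
        (8, {a, c, d, e}, {a, c, d, e}, {a, b, c, d, e}), (3, {a}, {b}, {a, b, d}),
        (10, {a}, {c, d}, {a, c, d, e}), (7, {b}, {c}, {a, b, c}),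
        (1, {b}, {d, e}, {a, b, c, d, e}), (2, {b}, {c, d, e}, {a, b, c, d, e}),
        (2, {a, b}, {e}, {a, b, c, d, e}), (9, {c}, {d}, {a, c, d, e}),
        (1, {c}, {b, d}, {a, b, c, d}), (1, {a, c}, {c, d}, {a, b, c, d}),
        (8, {b, c}, {d}, {a, b, c, d}), (2, {b, c}, {e}, {a, b, c, d, e}),
        (1, {a, d}, {e}, {a, c, d, e}), (2, {b, d}, {c, e}, {a, b, c, d, e}),
        (1, {c, d}, {d, e}, {a, c, d, e}), (3, {a, e}, {b, e}, {a, b, d, e}),
        (3, {a, e}, {c, e}, {a, b, c, e}), (2, {a, e}, {d, e}, {a, b, d, e}),
        (8, {b, e}, {c, e}, {a, b, c, e}), (9, {b, c, e}, {d, e}, {a, b, c, d, e})]"])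
      (simp_all add: certificate_simps neqs)
  then show ?thesis
    by (simp add: numeral_eq_Suc neqs)
qed

text \<open>The symmetries of the family fix \<open>a\<close> and permute the other four points
  transitively, hence only two weight values; the same holds in \<open>FC_d\<close>.\<close>

lemma FC_c:
  "FC 5 {{}, {a, b, c}, {a, d, e}, {b, c, d, e}, {a, b, c, d, e}}" (is "FC 5 ?B")
proof -
  have "FC (card {a, b, c, d, e}) ?B"
    by (rule FC_certificate[where c = "\<lambda>x. 4 * of_bool (x = a) + 3 * of_bool (x = b) + 3 * of_bool (x = c) +
        3 * of_bool (x = d) + 3 * of_bool (x = e)" and cs = "[
        (14, {}, {}, {a, b, c}), (2, {}, {}, {b, c, d, e}), (6, {b}, {b}, {a, b, d, e}),
        (8, {c}, {c}, {a, c, d, e}), (12, {a, b, c}, {a, b, c}, {a, b, c, d, e}),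
        (8, {d}, {d}, {a, b, c, d}), (4, {e}, {e}, {a, b, c, e}), (2, {a}, {b}, {a, b, c}),
        (2, {a}, {c, d}, {a, b, c, d, e}), (4, {a}, {e}, {a, d, e}),
        (2, {b}, {d, e}, {b, c, d, e}), (4, {a, b}, {b, d}, {a, b, d, e}),
        (2, {c}, {d, e}, {a, b, c, d, e}), (2, {a, c}, {c, e}, {a, c, d, e}),
        (2, {b, c}, {d}, {b, c, d, e}), (2, {b, c}, {e}, {b, c, d, e}),
        (2, {a, d}, {c, d}, {a, b, c, d}), (4, {a, e}, {b, e}, {a, b, c, e}),
        (2, {a, e}, {c, e}, {a, b, c, e})]"])
      (simp_all add: certificate_simps neqs)
  then show ?thesis
    by (simp add: numeral_eq_Suc neqs)
qed

lemma FC_d: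
  "FC 5 {{}, {a, b, c}, {a, d, e}, {a, b, c, d}, {a, b, c, e}, {a, b, d, e}, {a, c, d, e},
    {a, b, c, d, e}}" (is "FC 5 ?B")
proof -
  have "FC (card {a, b, c, d, e}) ?B"
    by (rule FC_certificate[where c = "\<lambda>x. 4 * of_bool (x = a) + 3 * of_bool (x = b) + 3 * of_bool (x = c) +
        3 * of_bool (x = d) + 3 * of_bool (x = e)" and cs = "[
        (4, {}, {}, {a, b, c}), (2, {}, {}, {a, b, c, d}), (4, {}, {}, {a, d, e}),
        (2, {}, {}, {a, b, d, e}), (4, {}, {}, {a, c, d, e}), (2, {c, d}, {c, d}, {a, c, d, e}),
        (2, {a, c, d, e}, {a, c, d, e}, {a, b, c, d, e}), (2, {a}, {d}, {a, b, c, d}),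
        (2, {a}, {b, d}, {a, b, c, d}), (4, {a}, {e}, {a, b, d, e}),
        (2, {b}, {c, d}, {a, b, c, d}), (4, {b}, {a, e}, {a, b, d, e}),
        (4, {b}, {c, e}, {a, b, c, e}), (2, {a, b}, {b, d}, {a, b, c, d}),
        (4, {c}, {a, d}, {a, c, d, e}), (2, {c}, {a, e}, {a, c, d, e}),
        (2, {c}, {b, e}, {a, b, c, e}), (2, {c}, {d, e}, {a, b, c, d, e}),
        (2, {a, c}, {e}, {a, b, c, d, e}), (4, {b, c}, {e}, {a, b, c, e}),
        (8, {d}, {b, c, e}, {a, b, c, d, e}), (2, {b, e}, {d, e}, {a, b, c, d, e})]"])
      (simp_all add: certificate_simps neqs)
  then show ?thesis
    by (simp add: numeral_eq_Suc neqs)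
qed

lemma FC_e:
  "FC 5 {{}, {a, b, c}, {a, b, d, e}, {a, c, d, e}, {b, c, d, e}, {a, b, c, d, e}}" (is "FC 5 ?B")
proof -
  have "FC (card {a, b, c, d, e}) ?B"
    by (rule FC_certificate[where c = "\<lambda>x. 2 * of_bool (x = a) + 2 * of_bool (x = b) + 2 * of_bool (x = c) +
        of_bool (x = d) + of_bool (x = e)" and cs = "[
        (4, {}, {}, {a, b, c}), (4, {}, {}, {a, c, d, e}), (6, {d}, {d}, {a, b, c, d}),
        (4, {e}, {e}, {a, b, c, e}), (4, {d, e}, {d, e}, {b, c, d, e}),
        (2, {b, c, d, e}, {b, c, d, e}, {a, b, c, d, e}), (2, {a}, {b, d}, {a, b, d, e}),
        (2, {a}, {c, e}, {a, b, c, d, e}), (2, {b}, {c, d}, {a, b, c, d, e}),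
        (2, {b}, {a, e}, {a, b, d, e}), (2, {c}, {a, d}, {a, b, c, d, e}),
        (2, {c}, {e}, {b, c, d, e}), (2, {b, e}, {c, e}, {a, b, c, e})]"])
      (simp_all add: certificate_simps neqs)
  then show ?thesis
    by (simp add: numeral_eq_Suc neqs)
qed

lemma FC_f:
  "FC 5 {{}, {a, b, c, d}, {a, b, c, e}, {a, b, d, e}, {a, c, d, e}, {b, c, d, e},
    {a, b, c, d, e}}" (is "FC 5 ?B")
proof -
  have "FC (card {a, b, c, d, e}) ?B"
    by (rule FC_certificate[where c = "\<lambda>x. of_bool (x = a) + of_bool (x = b) + of_bool (x = c) +
        of_bool (x = d) + of_bool (x = e)" and cs = "[
        (1, {}, {}, {a, b, d, e}), (2, {}, {}, {a, b, c, d}), (1, {}, {}, {a, c, d, e}),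
        (1, {}, {}, {a, b, c, d, e}), (1, {a, c}, {a, c}, {a, c, d, e}),
        (1, {e}, {e}, {b, c, d, e}), (3, {a}, {c}, {a, b, c, e}),
        (1, {b}, {a, c}, {a, b, c, d, e}), (1, {b}, {a, e}, {a, b, d, e}),
        (1, {b}, {c, e}, {b, c, d, e}), (1, {a, b}, {d}, {a, b, c, d, e}),
        (1, {a, c}, {d}, {a, b, c, d, e}), (1, {a, c}, {e}, {a, c, d, e}),
        (1, {b, c}, {d}, {a, b, c, d}), (1, {a, d}, {e}, {a, b, d, e}),
        (1, {b, d}, {b, e}, {a, b, c, d, e}), (1, {c, d}, {d, e}, {b, c, d, e})]"])
      (simp_all add: certificate_simps neqs)
  then show ?thesis
    by (simp add: numeral_eq_Suc neqs)
qed

section \<open>Maximal non-FC families on five points\<close>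

lemma sum_Pow_five:
  "(\<Sum>Z\<in>Pow {a, b, c, d, e}. g Z :: int) =
      g {} + g {a} + g {b} + g {c} + g {d} + g {e} + g {a, b} + g {a, c} + g {a, d} +
      g {a, e} + g {b, c} + g {b, d} + g {b, e} + g {c, d} + g {c, e} + g {d, e} +
      g {a, b, c} + g {a, b, d} + g {a, b, e} + g {a, c, d} + g {a, c, e} + g {a, d, e} +
      g {b, c, d} + g {b, c, e} + g {b, d, e} + g {c, d, e} + g {a, b, c, d} + g {a, b, c, e} +
      g {a, b, d, e} + g {a, c, d, e} + g {b, c, d, e} + g {a, b, c, d, e}"
  by (simp add: sum_Pow_insert insert_commute neqs)

text \<open>Every nonempty member contains \<open>a\<close>, and every 4-set through
  \<open>a\<close> is present.\<close>

lemma non_FC_one_triple: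
  "non_FC {{}, {a, b, c}, {a, b, c, d}, {a, b, c, e}, {a, b, d, e}, {a, c, d, e}, {a, b, c, d, e}}"
  by (rule non_FC_if_balance_neg[where L = "{a, b, c, d, e}" and
      \<mu> = "\<lambda>x. 17 * of_bool (x = a) + 12 * of_bool (x = b) + 12 * of_bool (x = c) +
        6 * of_bool (x = d) + 6 * of_bool (x = e)"])
    (simp_all add: certificate_simps neqs,
      simp_all add: balance_join_avoiding sum_Pow_five neqs)

text \<open>Every nonempty member contains both \<open>a\<close> and \<open>b\<close>, and every
  4-set through these two points is present.\<close>

lemma non_FC_two_triples_meeting_in_two:
  "non_FC {{}, {a, b, c}, {a, b, d}, {a, b, c, d}, {a, b, c, e}, {a, b, d, e}, {a, b, c, d, e}}"
  by (rule non_FC_if_balance_neg[where L = "{a, b, c, d, e}" and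
      \<mu> = "\<lambda>x. 5 * of_bool (x = a) + 5 * of_bool (x = b) + 2 * of_bool (x = c) +
        2 * of_bool (x = d) + of_bool (x = e)"])
    (simp_all add: certificate_simps neqs,
      simp_all add: balance_join_avoiding sum_Pow_five neqs)

text \<open>The 4-sets are exactly those through both \<open>a\<close> and \<open>b\<close>; by the
  symmetry of the two 3-sets, any point other than \<open>a\<close> could take the place of
  \<open>b\<close>.\<close>

lemma non_FC_two_triples_meeting_in_one:
  "non_FC {{}, {a, b, c}, {a, d, e}, {a, b, c, d}, {a, b, c, e}, {a, b, d, e}, {a, b, c, d, e}}"
  by (rule non_FC_if_balance_neg[where L = "{a, b, c, d, e}" and
      \<mu> = "\<lambda>x. 36 * of_bool (x = a) + 19 * of_bool (x = b) + 17 * of_bool (x = c) +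
        16 * of_bool (x = d) + 16 * of_bool (x = e)"])
    (simp_all add: certificate_simps neqs,
      simp_all add: balance_join_avoiding sum_Pow_five neqs)

end

subsection \<open>Generated families and minimality\<close>

lemma Union_mem_union_closed:
  assumes "finite T" "T \<subseteq> A" "union_closed A" "{} \<in> A"
  shows "\<Union>T \<in> A"
  using assms(1,2) by induction (use assms(3,4) in \<open>auto simp: union_closed_def\<close>)

lemma generated_family_props:
  "S \<subseteq> generated_family S" "{} \<in> generated_family S" "union_closed (generated_family S)"
proof -
  have "union_closed (union_closed hull (S \<union> {{}}))"
    by (rule hull_in) (auto simp: union_closed_def)
  then show "union_closed (generated_family S)"
    by (simp add: generated_family_def)
  show "S \<subseteq> generated_family S" "{} \<in> generated_family S"
    using hull_subset[of "S \<union> {{}}" union_closed] by (auto simp: generated_family_def)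
qed

lemma generated_family_least:
  assumes "S \<subseteq> A" "{} \<in> A" "union_closed A"
  shows "generated_family S \<subseteq> A"
  unfolding generated_family_def using assms by (intro hull_minimal) auto

lemma generated_family_eq_Unions:
  assumes "finite S"
  shows "generated_family S = Union ` Pow S"
proof (rule subset_antisym)
  have "union_closed (Union ` Pow S)"
    unfolding union_closed_def
  proof (intro ballI)
    fix X Y
    assume "X \<in> Union ` Pow S" "Y \<in> Union ` Pow S"
    then obtain T U where "T \<subseteq> S" "U \<subseteq> S" "X = \<Union>T" "Y = \<Union>U"
      by auto
    then show "X \<union> Y \<in> Union ` Pow S"
      by (intro image_eqI[of _ _ "T \<union> U"]) auto
  qed
  moreover have "S \<subseteq> Union ` Pow S" "{} \<in> Union ` Pow S"
    by (auto intro: image_eqI[of _ _ "{X}" for X] image_eqI[of _ _ "{}"])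
  ultimately show "generated_family S \<subseteq> Union ` Pow S"
    by (intro generated_family_least)
  show "Union ` Pow S \<subseteq> generated_family S"
    using assms generated_family_props[of S]
    by (auto intro!: Union_mem_union_closed intro: finite_subset)
qed

lemma image_generated_family:
  assumes "finite S"
  shows "(`) p ` generated_family S = generated_family ((`) p ` S)"
proof -
  have "(`) p ` Union ` Pow S = Union ` (`) ((`) p) ` Pow S"
    by (simp add: image_image image_Union)
  then show ?thesis
    using assms by (simp add: generated_family_eq_Unions flip: image_Pow_surj)
qed

text \<open>\<open>cover\<close> exhibits every member of \<open>G\<close> as the union of the
  generators inside it, a condition that can be checked on explicit sets.\<close>

lemma generated_family_eqI:
  assumes S: "finite S" "S \<subseteq> G" and G: "{} \<in> G" "union_closed G"
    and cover: "\<forall>X\<in>G. \<forall>x\<in>X. \<exists>Y\<in>S. x \<in> Y \<and> Y \<subseteq> X"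
  shows "generated_family S = G"
proof
  show "generated_family S \<subseteq> G"
    using S G by (intro generated_family_least)
  show "G \<subseteq> generated_family S"
  proof
    fix X
    assume "X \<in> G"
    then have "X = \<Union>{Y \<in> S. Y \<subseteq> X}"
      using cover by blast
    then show "X \<in> generated_family S"
      unfolding generated_family_eq_Unions[OF S(1)] by (intro image_eqI) auto
  qed
qed

text \<open>A strictly smaller FC-family is union-closed and contains \<open>{}\<close>, so it must
  miss a generator \<open>s\<close> and lies in \<open>G - {s}\<close>. Hence only deletions of
  single generators have to be examined.\<close>

lemma proper_FCI:
  assumes gen: "generated_family S = G" and FC: "FC k G" and min: "\<forall>s\<in>S. non_FC (G - {s})"
  shows "proper_FC k (generated_family S)"
proof -
  have "\<not> FC_family C" if C: "C \<subset> G" for C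
  proof
    assume FC_C: "FC_family C"
    then have "union_closed C" "{} \<in> C"
      by (auto simp: FC_family_def FC_def)
    then have "\<not> S \<subseteq> C"
      using generated_family_least[of S C] C gen by blast
    then show False
      using min C FC_C unfolding non_FC_def by blast
  qed
  then show ?thesis
    using FC gen by (auto simp: proper_FC_def)
qed

section \<open>Properness of the listed families\<close>

text \<open>Any two of the generators meet in \<open>{a, b}\<close>, so every deletion leaves two
  3-sets meeting in two points.\<close>

lemma proper_FC_triangle:
  assumes "distinct [a, b, c, d, e]"
  shows "proper_FC 5 (generated_family {{a, b, c}, {a, b, d}, {a, b, e}})"
proof (rule proper_FCI)
  let ?G = "{{}, {a, b, c}, {a, b, d}, {a, b, e}, {a, b, c, d}, {a, b, c, e}, {a, b, d, e}, {a, b, c, d, e}}"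
  note simps = certificate_simps insert_Diff_if distinct_five_neqs[OF assms]
  show "generated_family {{a, b, c}, {a, b, d}, {a, b, e}} = ?G"
    by (rule generated_family_eqI) (simp_all add: simps)
  show "FC 5 ?G"
    by (rule FC_triangle[OF assms])
  have n1: "non_FC (?G - {{a, b, c}})"
    by (rule non_FC_subset[OF non_FC_two_triples_meeting_in_two[of a b d e c]]) (simp_all add: simps)
  have n2: "non_FC (?G - {{a, b, d}})"
    by (rule non_FC_subset[OF non_FC_two_triples_meeting_in_two[of a b c e d]]) (simp_all add: simps)
  have n3: "non_FC (?G - {{a, b, e}})"
    by (rule non_FC_subset[OF non_FC_two_triples_meeting_in_two[of a b c d e]]) (simp_all add: simps)
  show "\<forall>s\<in>{{a, b, c}, {a, b, d}, {a, b, e}}. non_FC (?G - {s})"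
    using n1 n2 n3 by blast
qed

lemma proper_FC_path:
  assumes "distinct [a, b, c, d, e]"
  shows "proper_FC 5 (generated_family {{a, b, c}, {a, b, d}, {a, d, e}})"
proof (rule proper_FCI)
  let ?G = "{{}, {a, b, c}, {a, b, d}, {a, d, e}, {a, b, c, d}, {a, b, d, e}, {a, b, c, d, e}}"
  note simps = certificate_simps insert_Diff_if distinct_five_neqs[OF assms]
  show "generated_family {{a, b, c}, {a, b, d}, {a, d, e}} = ?G"
    by (rule generated_family_eqI) (simp_all add: simps)
  show "FC 5 ?G"
    by (rule FC_path[OF assms])
  have n1: "non_FC (?G - {{a, b, c}})"
    by (rule non_FC_subset[OF non_FC_two_triples_meeting_in_two[of a d b e c]]) (simp_all add: simps)
  have n2: "non_FC (?G - {{a, b, d}})"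
    by (rule non_FC_subset[OF non_FC_two_triples_meeting_in_one[of a b c d e]]) (simp_all add: simps)
  have n3: "non_FC (?G - {{a, d, e}})"
    by (rule non_FC_subset[OF non_FC_two_triples_meeting_in_two[of a b c d e]]) (simp_all add: simps)
  show "\<forall>s\<in>{{a, b, c}, {a, b, d}, {a, d, e}}. non_FC (?G - {s})"
    using n1 n2 n3 by blast
qed

lemma proper_FC_path_edge:
  assumes "distinct [a, b, c, d, e]"
  shows "proper_FC 5 (generated_family {{a, b, c}, {a, b, d}, {c, d, e}})"
proof (rule proper_FCI)
  let ?G = "{{}, {a, b, c}, {a, b, d}, {c, d, e}, {a, b, c, d}, {a, b, c, d, e}}"
  note simps = certificate_simps insert_Diff_if distinct_five_neqs[OF assms]
  show "generated_family {{a, b, c}, {a, b, d}, {c, d, e}} = ?G"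
    by (rule generated_family_eqI) (simp_all add: simps)
  show "FC 5 ?G"
    by (rule FC_path_edge[OF assms])
  have n1: "non_FC (?G - {{a, b, c}})"
    by (rule non_FC_subset[OF non_FC_two_triples_meeting_in_one[of d a b c e]]) (simp_all add: simps)
  have n2: "non_FC (?G - {{a, b, d}})"
    by (rule non_FC_subset[OF non_FC_two_triples_meeting_in_one[of c a b d e]]) (simp_all add: simps)
  have n3: "non_FC (?G - {{c, d, e}})"
    by (rule non_FC_subset[OF non_FC_two_triples_meeting_in_two[of a b c d e]]) (simp_all add: simps)
  show "\<forall>s\<in>{{a, b, c}, {a, b, d}, {c, d, e}}. non_FC (?G - {s})"
    using n1 n2 n3 by blast
qed

lemma proper_FC_b:
  assumes "distinct [a, b, c, d, e]"
  shows "proper_FC 5 (generated_family {{a, b, c}, {a, b, d}, {a, c, d, e}})"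
proof (rule proper_FCI)
  let ?G = "{{}, {a, b, c}, {a, b, d}, {a, b, c, d}, {a, c, d, e}, {a, b, c, d, e}}"
  note simps = certificate_simps insert_Diff_if distinct_five_neqs[OF assms]
  show "generated_family {{a, b, c}, {a, b, d}, {a, c, d, e}} = ?G"
    by (rule generated_family_eqI) (simp_all add: simps)
  show "FC 5 ?G"
    by (rule FC_b[OF assms])
  have n1: "non_FC (?G - {{a, b, c}})"
    by (rule non_FC_subset[OF non_FC_one_triple[of a b d c e]]) (simp_all add: simps)
  have n2: "non_FC (?G - {{a, b, d}})"
    by (rule non_FC_subset[OF non_FC_one_triple[of a b c d e]]) (simp_all add: simps)
  have n3: "non_FC (?G - {{a, c, d, e}})"
    by (rule non_FC_subset[OF non_FC_two_triples_meeting_in_two[of a b c d e]]) (simp_all add: simps)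
  show "\<forall>s\<in>{{a, b, c}, {a, b, d}, {a, c, d, e}}. non_FC (?G - {s})"
    using n1 n2 n3 by blast
qed

lemma proper_FC_c:
  assumes "distinct [a, b, c, d, e]"
  shows "proper_FC 5 (generated_family {{a, b, c}, {a, d, e}, {b, c, d, e}})"
proof (rule proper_FCI)
  let ?G = "{{}, {a, b, c}, {a, d, e}, {b, c, d, e}, {a, b, c, d, e}}"
  note simps = certificate_simps insert_Diff_if distinct_five_neqs[OF assms]
  show "generated_family {{a, b, c}, {a, d, e}, {b, c, d, e}} = ?G"
    by (rule generated_family_eqI) (simp_all add: simps)
  show "FC 5 ?G"
    by (rule FC_c[OF assms])
  have n1: "non_FC (?G - {{a, b, c}})"
    by (rule non_FC_subset[OF non_FC_one_triple[of d a e b c]]) (simp_all add: simps)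
  have n2: "non_FC (?G - {{a, d, e}})"
    by (rule non_FC_subset[OF non_FC_one_triple[of b a c d e]]) (simp_all add: simps)
  have n3: "non_FC (?G - {{b, c, d, e}})"
    by (rule non_FC_subset[OF non_FC_two_triples_meeting_in_one[of a b c d e]]) (simp_all add: simps)
  show "\<forall>s\<in>{{a, b, c}, {a, d, e}, {b, c, d, e}}. non_FC (?G - {s})"
    using n1 n2 n3 by blast
qed

text \<open>All generators contain \<open>a\<close>. Deleting the 4-set that omits \<open>x\<close>
  leaves only 4-sets through both \<open>a\<close> and \<open>x\<close>, so \<open>x\<close> takes
  the second place in the enumeration.\<close>

lemma proper_FC_d:
  assumes "distinct [a, b, c, d, e]"
  shows "proper_FC 5 (generated_family {{a, b, c}, {a, d, e}, {a, b, c, d}, {a, b, c, e}, {a, b, d, e}, {a, c, d, e}})"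
proof (rule proper_FCI)
  let ?G = "{{}, {a, b, c}, {a, d, e}, {a, b, c, d}, {a, b, c, e}, {a, b, d, e}, {a, c, d, e}, {a, b, c, d, e}}"
  note simps = certificate_simps insert_Diff_if distinct_five_neqs[OF assms]
  show "generated_family {{a, b, c}, {a, d, e}, {a, b, c, d}, {a, b, c, e}, {a, b, d, e}, {a, c, d, e}} = ?G"
    by (rule generated_family_eqI) (simp_all add: simps)
  show "FC 5 ?G"
    by (rule FC_d[OF assms])
  have n1: "non_FC (?G - {{a, b, c}})"
    by (rule non_FC_subset[OF non_FC_one_triple[of a d e b c]]) (simp_all add: simps)
  have n2: "non_FC (?G - {{a, d, e}})"
    by (rule non_FC_subset[OF non_FC_one_triple[of a b c d e]]) (simp_all add: simps)
  have n3: "non_FC (?G - {{a, b, c, d}})"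
    by (rule non_FC_subset[OF non_FC_two_triples_meeting_in_one[of a e d b c]]) (simp_all add: simps)
  have n4: "non_FC (?G - {{a, b, c, e}})"
    by (rule non_FC_subset[OF non_FC_two_triples_meeting_in_one[of a d e b c]]) (simp_all add: simps)
  have n5: "non_FC (?G - {{a, b, d, e}})"
    by (rule non_FC_subset[OF non_FC_two_triples_meeting_in_one[of a c b d e]]) (simp_all add: simps)
  have n6: "non_FC (?G - {{a, c, d, e}})"
    by (rule non_FC_subset[OF non_FC_two_triples_meeting_in_one[of a b c d e]]) (simp_all add: simps)
  show "\<forall>s\<in>{{a, b, c}, {a, d, e}, {a, b, c, d}, {a, b, c, e}, {a, b, d, e}, {a, c, d, e}}. non_FC (?G - {s})"
    using n1 n2 n3 n4 n5 n6 by blast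
qed

text \<open>After any deletion the nonempty members still have a common point, and at most one of
  them is a 3-set.\<close>

lemma proper_FC_e:
  assumes "distinct [a, b, c, d, e]"
  shows "proper_FC 5 (generated_family {{a, b, c}, {a, b, d, e}, {a, c, d, e}, {b, c, d, e}})"
proof (rule proper_FCI)
  let ?G = "{{}, {a, b, c}, {a, b, d, e}, {a, c, d, e}, {b, c, d, e}, {a, b, c, d, e}}"
  note simps = certificate_simps insert_Diff_if distinct_five_neqs[OF assms]
  show "generated_family {{a, b, c}, {a, b, d, e}, {a, c, d, e}, {b, c, d, e}} = ?G"
    by (rule generated_family_eqI) (simp_all add: simps)
  show "FC 5 ?G"
    by (rule FC_e[OF assms])
  have n1: "non_FC (?G - {{a, b, c}})"
    by (rule non_FC_subset[OF non_FC_one_triple[of d a b c e]]) (simp_all add: simps)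
  have n2: "non_FC (?G - {{a, b, d, e}})"
    by (rule non_FC_subset[OF non_FC_one_triple[of c a b d e]]) (simp_all add: simps)
  have n3: "non_FC (?G - {{a, c, d, e}})"
    by (rule non_FC_subset[OF non_FC_one_triple[of b a c d e]]) (simp_all add: simps)
  have n4: "non_FC (?G - {{b, c, d, e}})"
    by (rule non_FC_subset[OF non_FC_one_triple[of a b c d e]]) (simp_all add: simps)
  show "\<forall>s\<in>{{a, b, c}, {a, b, d, e}, {a, c, d, e}, {b, c, d, e}}. non_FC (?G - {s})"
    using n1 n2 n3 n4 by blast
qed

text \<open>Deleting the 4-set that omits \<open>x\<close> leaves \<open>x\<close> in every nonempty
  member.\<close>

lemma proper_FC_f:
  assumes "distinct [a, b, c, d, e]"
  shows "proper_FC 5 (generated_family {{a, b, c, d}, {a, b, c, e}, {a, b, d, e}, {a, c, d, e}, {b, c, d, e}})"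
proof (rule proper_FCI)
  let ?G = "{{}, {a, b, c, d}, {a, b, c, e}, {a, b, d, e}, {a, c, d, e}, {b, c, d, e}, {a, b, c, d, e}}"
  note simps = certificate_simps insert_Diff_if distinct_five_neqs[OF assms]
  show "generated_family {{a, b, c, d}, {a, b, c, e}, {a, b, d, e}, {a, c, d, e}, {b, c, d, e}} = ?G"
    by (rule generated_family_eqI) (simp_all add: simps)
  show "FC 5 ?G"
    by (rule FC_f[OF assms])
  have n1: "non_FC (?G - {{a, b, c, d}})"
    by (rule non_FC_subset[OF non_FC_one_triple[of e a b c d]]) (simp_all add: simps)
  have n2: "non_FC (?G - {{a, b, c, e}})"
    by (rule non_FC_subset[OF non_FC_one_triple[of d a b c e]]) (simp_all add: simps)
  have n3: "non_FC (?G - {{a, b, d, e}})"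
    by (rule non_FC_subset[OF non_FC_one_triple[of c a b d e]]) (simp_all add: simps)
  have n4: "non_FC (?G - {{a, c, d, e}})"
    by (rule non_FC_subset[OF non_FC_one_triple[of b a c d e]]) (simp_all add: simps)
  have n5: "non_FC (?G - {{b, c, d, e}})"
    by (rule non_FC_subset[OF non_FC_one_triple[of a b c d e]]) (simp_all add: simps)
  show "\<forall>s\<in>{{a, b, c, d}, {a, b, c, e}, {a, b, d, e}, {a, c, d, e}, {b, c, d, e}}. non_FC (?G - {s})"
    using n1 n2 n3 n4 n5 by blast
qed

subsection \<open>Classification on five points\<close>

lemma nsets_4_of_five:
  assumes "distinct [a, b, c, d, e]"
  shows "nsets {a, b, c, d, e} 4 =
    {{a, b, c, d}, {a, b, c, e}, {a, b, d, e}, {a, c, d, e}, {b, c, d, e}}" (is "nsets ?L 4 = ?N")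
proof
  note neqs = distinct_five_neqs[OF assms]
  have card_L: "card ?L = 5"
    by (simp add: neqs)
  show "nsets ?L 4 \<subseteq> ?N"
  proof
    fix X
    assume X: "X \<in> nsets ?L 4"
    then have "card (?L - X) = 1"
      using card_L by (subst card_Diff_subset) (auto simp: nsets_def)
    then obtain x where x: "?L - X = {x}"
      by (auto simp: card_1_singleton_iff)
    have "X \<subseteq> ?L"
      using X by (simp add: nsets_def)
    with x have "X = ?L - {x}" "x \<in> ?L"
      by blast+
    moreover have "?L - {x} \<in> ?N" if "x \<in> ?L"
      using that by (elim insertE emptyE) (simp_all add: neqs insert_Diff_if)
    ultimately show "X \<in> ?N"
      by metis
  qed
  show "?N \<subseteq> nsets ?L 4"
    by (auto simp: nsets_def neqs)
qed

lemma nsets_3_of_five: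
  assumes "distinct [a, b, c, d, e]"
  shows "nsets {a, b, c, d, e} 3 =
    {{a, b, c}, {a, b, d}, {a, b, e}, {a, c, d}, {a, c, e}, {a, d, e}, {b, c, d}, {b, c, e},
     {b, d, e}, {c, d, e}}" (is "nsets ?L 3 = ?N")
proof
  note neqs = distinct_five_neqs[OF assms]
  have card_L: "card ?L = 5"
    by (simp add: neqs)
  show "nsets ?L 3 \<subseteq> ?N"
  proof
    fix X
    assume X: "X \<in> nsets ?L 3"
    then have "card (?L - X) = 2"
      using card_L by (subst card_Diff_subset) (auto simp: nsets_def)
    then obtain x y where xy: "?L - X = {x, y}" "x \<noteq> y"
      by (auto simp: card_2_iff)
    have "X \<subseteq> ?L"
      using X by (simp add: nsets_def)
    with xy have "X = ?L - {x} - {y}" "x \<in> ?L" "y \<in> ?L"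
      by blast+
    moreover have "?L - {x} - {y} \<in> ?N" if "x \<in> ?L" "y \<in> ?L"
      using that xy(2) by (elim insertE emptyE) (simp_all add: neqs insert_Diff_if)
    ultimately show "X \<in> ?N"
      by metis
  qed
  show "?N \<subseteq> nsets ?L 3"
    by (auto simp: nsets_def neqs)
qed

lemma distinct_five_if_card:
  assumes "card {a, b, c, d, e} = 5"
  shows "distinct [a, b, c, d, e]"
  by (rule card_distinct) (use assms in simp)

text \<open>The sizes of \<open>X \<union> Y\<close> and \<open>X \<inter> Y\<close> add up to 6 and
  the former is at most 5, so distinct 3-sets meet in one or two points; the five points are named
  accordingly.\<close>

lemma two_triples_cases:
  assumes L: "card L = 5" and X: "X \<in> nsets L 3" and Y: "Y \<in> nsets L 3" and neq: "X \<noteq> Y"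
  obtains a b c d e where "distinct [a, b, c, d, e]" "L = {a, b, c, d, e}"
      "X = {a, b, c}" "Y = {a, b, d}"
    | a b c d e where "distinct [a, b, c, d, e]" "L = {a, b, c, d, e}"
      "X = {a, b, c}" "Y = {a, d, e}"
proof -
  have XY: "X \<subseteq> L" "finite X" "card X = 3" "Y \<subseteq> L" "finite Y" "card Y = 3" and fin: "finite L"
    using assms by (auto simp: nsets_def card_ge_0_finite)
  have "card (X \<union> Y) + card (X \<inter> Y) = 6" "card (X \<union> Y) \<le> 5"
    using card_Un_Int[of X Y] XY card_mono[of L "X \<union> Y"] fin L by auto
  moreover have "card (X \<inter> Y) \<noteq> 3"
    using XY neq by (metis card_subset_eq inf.cobounded1 inf.cobounded2)
  moreover have "card (X \<inter> Y) \<le> 3"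
    using XY by (metis card_mono inf.cobounded1)
  ultimately consider "card (X \<inter> Y) = 1" "card (X \<union> Y) = 5" | "card (X \<inter> Y) = 2" "card (X \<union> Y) = 4"
    by linarith
  then show thesis
  proof cases
    case 1
    then have "card (X - Y) = 2" "card (Y - X) = 2"
      using XY card_Diff_subset_Int[of X Y] card_Diff_subset_Int[of Y X] by (auto simp: Int_commute)
    then obtain b c d e where *: "X - Y = {b, c}" "b \<noteq> c" "Y - X = {d, e}" "d \<noteq> e"
      by (auto simp: card_2_iff)
    obtain a where a: "X \<inter> Y = {a}"
      using 1 by (auto simp: card_1_singleton_iff)
    have "X \<union> Y = L"
      using 1 XY fin L by (intro card_subset_eq) auto
    moreover have "X = X \<inter> Y \<union> (X - Y)" "Y = X \<inter> Y \<union> (Y - X)"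
      by blast+
    ultimately have eqs: "X = {a, b, c}" "Y = {a, d, e}" "L = {a, b, c, d, e}"
      unfolding a * by auto
    moreover have "distinct [a, b, c, d, e]"
      using L unfolding eqs(3) by (rule distinct_five_if_card)
    ultimately show ?thesis
      by (intro that(2))
  next
    case 2
    then have "card (X - Y) = 1" "card (Y - X) = 1"
      using XY card_Diff_subset_Int[of X Y] card_Diff_subset_Int[of Y X] by (auto simp: Int_commute)
    then obtain c d where *: "X - Y = {c}" "Y - X = {d}"
      by (auto simp: card_1_singleton_iff)
    obtain a b where ab: "X \<inter> Y = {a, b}" "a \<noteq> b"
      using 2 by (auto simp: card_2_iff)
    have "card (L - (X \<union> Y)) = 1"
      using 2 XY L by (subst card_Diff_subset) auto
    then obtain e where e: "L - (X \<union> Y) = {e}"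
      by (auto simp: card_1_singleton_iff)
    have "X = X \<inter> Y \<union> (X - Y)" "Y = X \<inter> Y \<union> (Y - X)" "L = X \<union> Y \<union> (L - (X \<union> Y))"
      using XY by blast+
    then have eqs: "X = {a, b, c}" "Y = {a, b, d}" "L = {a, b, c, d, e}"
      unfolding ab(1) * e by auto
    moreover have "distinct [a, b, c, d, e]"
      using L unfolding eqs(3) by (rule distinct_five_if_card)
    ultimately show ?thesis
      by (intro that(1))
  qed
qed

text \<open>
  The case \<open>L \<notin> generated_family S\<close> does occur: three 3-sets inside one 4-set generate an
  \<open>FC(4)\<close>-family.
\<close>

definition critical :: "nat set \<Rightarrow> nat set set \<Rightarrow> bool" where
  "critical L S \<longleftrightarrow> FC_family (generated_family S) \<and>
     (L \<in> generated_family S \<longrightarrow> proper_FC 5 (generated_family S))"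

lemma critical_if_proper: "proper_FC 5 (generated_family S) \<Longrightarrow> critical L S"
  by (auto simp: critical_def proper_FC_def FC_family_def)

text \<open>The point \<open>e\<close> of \<open>L\<close> lies in no generator, so the properness
  clause of \<open>critical\<close> is vacuous.\<close>

lemma critical_star:
  assumes "distinct [a, b, c, d, e]" "e \<in> L"
  shows "critical L {{a, b, c}, {a, b, d}, {a, c, d}}"
proof -
  note simps = certificate_simps distinct_five_neqs[OF assms(1)]
  have gen: "generated_family {{a, b, c}, {a, b, d}, {a, c, d}} =
      {{}, {a, b, c}, {a, b, d}, {a, c, d}, {a, b, c, d}}"
    by (rule generated_family_eqI) (simp_all add: simps)
  have "L \<notin> Pow {a, b, c, d}"
    using assms(2) distinct_five_neqs[OF assms(1)] by auto
  then have "L \<notin> {{}, {a, b, c}, {a, b, d}, {a, c, d}, {a, b, c, d}}"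
    by auto
  moreover have "FC_family {{}, {a, b, c}, {a, b, d}, {a, c, d}, {a, b, c, d}}"
    using FC_star[OF assms(1)] unfolding FC_family_def by blast
  ultimately show ?thesis
    unfolding critical_def gen by blast
qed

text \<open>Fixing the position of two of the 3-sets leaves eight candidates for the third, each
  giving one of the four graph shapes up to renaming.\<close>

lemma critical_three_triples:
  assumes L: "card L = 5" and S: "S \<subseteq> nsets L 3" "card S = 3"
  shows "critical L S"
proof -
  obtain X Y Z where XYZ: "S = {X, Y, Z}" "X \<noteq> Y" "X \<noteq> Z" "Y \<noteq> Z"
    using S(2) by (auto simp: card_3_iff)
  with S have XY: "X \<in> nsets L 3" "Y \<in> nsets L 3" and Z: "Z \<in> nsets L 3"
    by auto
  note triangle = proper_FC_triangle[THEN critical_if_proper, of _ _ _ _ _ L]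
    and path = proper_FC_path[THEN critical_if_proper, of _ _ _ _ _ L]
    and path_edge = proper_FC_path_edge[THEN critical_if_proper, of _ _ _ _ _ L]
  from L XY XYZ(2) show ?thesis
  proof (cases rule: two_triples_cases)
    case (1 a b c d e)
    have "Z \<in> {{a, b, e}, {a, c, d}, {a, c, e}, {a, d, e}, {b, c, d}, {b, c, e}, {b, d, e}, {c, d, e}}"
      using Z XYZ 1 nsets_3_of_five[OF 1(1)] by auto
    then show ?thesis
      unfolding XYZ(1) 1(3,4)
      using triangle[of a b c d e] critical_star[of a b c d e L] path[of a b d c e]
        path[of a b c d e] critical_star[of b a c d e L] path[of b a d c e] path[of b a c d e]
        path_edge[of a b c d e] distinct_five_neqs[OF 1(1)] 1(2)
      by (auto simp: insert_commute)
  next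
    case (2 a b c d e)
    \<comment> \<open>As \<open>X\<close> and \<open>Y\<close> have disjoint complements, neither a
      star nor a triangle can occur.\<close>
    have "Z \<in> {{a, b, d}, {a, b, e}, {a, c, d}, {a, c, e}, {b, c, d}, {b, c, e}, {b, d, e}, {c, d, e}}"
      using Z XYZ 2 nsets_3_of_five[OF 2(1)] by auto
    then show ?thesis
      unfolding XYZ(1) 2(3,4)
      using path[of a b c d e] path[of a b c e d] path[of a c b d e] path[of a c b e d]
        path_edge[of b c a d e] path_edge[of b c a e d] path_edge[of d e a b c]
        path_edge[of d e a c b] distinct_five_neqs[OF 2(1)]
      by (auto simp: insert_commute)
  qed
qed

section \<open>Listed systems and the case distinction on 3-sets\<close>

text \<open>Letting \<open>a\<close>, ..., \<open>e\<close> range over all enumerations of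
  \<open>L\<close> takes the place of a permutation; the clauses on all 3-sets and 4-sets are
  invariant by themselves.\<close>

definition listed :: "nat set \<Rightarrow> nat set set \<Rightarrow> bool" where
  "listed L S \<longleftrightarrow> S \<subseteq> nsets L 3 \<and> card S = 3 \<or> S = nsets L 4 \<or>
    (\<exists>a b c d e. distinct [a, b, c, d, e] \<and> L = {a, b, c, d, e} \<and>
      (S = {{a, b, c}, {a, b, d}, {a, c, d, e}} \<or>
       S = {{a, b, c}, {a, d, e}, {b, c, d, e}} \<or>
       S = {{a, b, c}, {a, d, e}, {a, b, c, d}, {a, b, c, e}, {a, b, d, e}, {a, c, d, e}} \<or>
       S = {{a, b, c}, {a, b, d, e}, {a, c, d, e}, {b, c, d, e}}))"

lemma listed_cases:
  assumes "distinct [a, b, c, d, e]"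
  shows
    listed_b: "listed {a, b, c, d, e} {{a, b, c}, {a, b, d}, {a, c, d, e}}" and
    listed_c: "listed {a, b, c, d, e} {{a, b, c}, {a, d, e}, {b, c, d, e}}" and
    listed_d: "listed {a, b, c, d, e}
      {{a, b, c}, {a, d, e}, {a, b, c, d}, {a, b, c, e}, {a, b, d, e}, {a, c, d, e}}" and
    listed_e: "listed {a, b, c, d, e} {{a, b, c}, {a, b, d, e}, {a, c, d, e}, {b, c, d, e}}"
  unfolding listed_def
  by (rule disjI2, rule disjI2, intro exI[of _ a] exI[of _ b] exI[of _ c] exI[of _ d] exI[of _ e],
    use assms in simp)+

lemma card_5_elements:
  assumes "card L = 5"
  obtains a b c d e where "distinct [a, b, c, d, e]" "L = {a, b, c, d, e}"
proof -
  obtain xs where xs: "distinct xs" "set xs = L"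
    using assms finite_distinct_list[of L] card_ge_0_finite[of L] by auto
  with assms have "length xs = 5"
    by (metis distinct_card)
  then obtain a b c d e where "xs = [a, b, c, d, e]"
    by (auto simp: numeral_eq_Suc length_Suc_conv)
  with xs show thesis
    by (intro that[of a b c d e]) auto
qed

lemma critical_if_listed:
  assumes L: "card L = 5" and S: "listed L S"
  shows "critical L S"
proof -
  have four: "critical L (nsets L 4)"
  proof -
    obtain a b c d e where "distinct [a, b, c, d, e]" "L = {a, b, c, d, e}"
      using card_5_elements[OF L] .
    then show ?thesis
      using critical_if_proper[OF proper_FC_f] nsets_4_of_five by metis
  qed
  show ?thesis
    using S unfolding listed_def
  proof (elim disjE exE conjE)
    assume "S \<subseteq> nsets L 3" "card S = 3"
    then show ?thesis
      by (rule critical_three_triples[OF L])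
  qed (use four in \<open>simp_all only: critical_if_proper proper_FC_b proper_FC_c proper_FC_d proper_FC_e\<close>)
qed

text \<open>\<open>U\<close> lists the possible members of \<open>B\<close> and \<open>Q\<close>
  some that are absent, so that only the inclusion \<open>U - Q \<subseteq> M\<close> between
  explicit families remains.\<close>

lemma non_FC_Diff:
  assumes "non_FC M" "B \<subseteq> U" "Q \<inter> B = {}" "U - Q \<subseteq> M"
  shows "non_FC B"
  by (rule non_FC_subset[OF assms(1)]) (use assms(2-4) in blast)

text \<open>Case distinction on the number of 3-sets in \<open>B\<close>: either the sets present
  complete a listed system, or the missing 4-sets place \<open>B\<close> inside a maximal non-FC
  family.\<close>

lemma non_FC_or_listed:
  assumes L: "card L = 5" and B: "B \<subseteq> Pow L"
    and small: "\<And>X. X \<in> B \<Longrightarrow> card X \<noteq> 1 \<and> card X \<noteq> 2"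
  shows "non_FC B \<or> (\<exists>S\<subseteq>B. listed L S)"
proof -
  define T where "T = B \<inter> nsets L 3"
  have finL: "finite L"
    using L card_ge_0_finite[of L] by simp
  have B_sub: "B \<subseteq> {{}, L} \<union> T \<union> nsets L 4"
  proof
    fix X
    assume X: "X \<in> B"
    then have XL: "X \<subseteq> L" "finite X"
      using B finite_subset[OF _ finL] by auto
    then have "card X \<le> 5"
      using card_mono[OF finL] L by metis
    then consider "card X = 0" | "card X = 3" | "card X = 4" | "card X = 5"
      using small[OF X] by linarith
    then show "X \<in> {{}, L} \<union> T \<union> nsets L 4"
    proof cases
      case 4
      then show ?thesis
        using XL L card_subset_eq[OF finL] by simp
    qed (use X XL in \<open>auto simp: T_def nsets_def\<close>)
  qed
  have finT: "finite T"
    unfolding T_def using finL by (simp add: finite_imp_finite_nsets)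
  consider "3 \<le> card T" | "card T = 2" | "card T = 1" | "card T = 0"
    by linarith
  then show ?thesis
  proof cases
    case 1
    then obtain S where "S \<subseteq> T" "card S = 3"
      by (meson obtain_subset_with_card_n)
    then have "S \<subseteq> B" "listed L S"
      unfolding listed_def T_def by simp_all
    then show ?thesis
      by blast
  next
    case 2
    then obtain X Y where T: "T = {X, Y}" "X \<noteq> Y"
      by (auto simp: card_2_iff)
    then have "X \<in> nsets L 3" "Y \<in> nsets L 3" and XY: "X \<in> B" "Y \<in> B"
      unfolding T_def by blast+
    from L this(1,2) T(2) show ?thesis
    proof (cases rule: two_triples_cases)
      case (1 a b c d e)
      have sub: "B \<subseteq> {{}, {a, b, c, d, e}} \<union> {{a, b, c}, {a, b, d}} \<union>
          {{a, b, c, d}, {a, b, c, e}, {a, b, d, e}, {a, c, d, e}, {b, c, d, e}}"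
        using B_sub unfolding T(1) 1(2-4) nsets_4_of_five[OF 1(1)] .
      \<comment> \<open>These are the two 4-sets that do not contain both \<open>a\<close> and
        \<open>b\<close>; exchanging \<open>a\<close> and \<open>b\<close> carries one to the
        other.\<close>
      consider "{a, c, d, e} \<in> B" | "{b, c, d, e} \<in> B" | "{a, c, d, e} \<notin> B" "{b, c, d, e} \<notin> B"
        by blast
      then show ?thesis
      proof cases
        case i: 1
        have "listed L {{a, b, c}, {a, b, d}, {a, c, d, e}}"
          using listed_b[OF 1(1)] 1(2) by simp
        moreover have "{{a, b, c}, {a, b, d}, {a, c, d, e}} \<subseteq> B"
          using XY 1(3,4) i by simp
        ultimately show ?thesis
          by blast
      next
        case i: 2
        have "distinct [b, a, c, d, e]" "L = {b, a, c, d, e}"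
          using 1(1,2) by auto
        then have "listed L {{b, a, c}, {b, a, d}, {b, c, d, e}}"
          using listed_b[of b a c d e] by simp
        moreover have "{{b, a, c}, {b, a, d}, {b, c, d, e}} \<subseteq> B"
          using XY 1(3,4) i by (simp add: insert_commute)
        ultimately show ?thesis
          by blast
      next
        case i: 3
        have "non_FC B"
          by (rule non_FC_Diff[OF non_FC_two_triples_meeting_in_two[OF 1(1)] sub,
                where Q = "{{a, c, d, e}, {b, c, d, e}}"])
            (use i in \<open>simp_all add: certificate_simps insert_Diff_if distinct_five_neqs[OF 1(1)]\<close>)
        then show ?thesis ..
      qed
    next
      case (2 a b c d e)
      have sub: "B \<subseteq> {{}, {a, b, c, d, e}} \<union> {{a, b, c}, {a, d, e}} \<union>
          {{a, b, c, d}, {a, b, c, e}, {a, b, d, e}, {a, c, d, e}, {b, c, d, e}}"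
        using B_sub unfolding T(1) 2(2-4) nsets_4_of_five[OF 2(1)] .
      \<comment> \<open>The second entry is the point omitted by the missing 4-set through
        \<open>a\<close>, in the order of the cases below.\<close>
      have perms: "distinct [a, b, c, d, e]" "distinct [a, c, b, d, e]" "distinct [a, d, e, b, c]"
        "distinct [a, e, d, b, c]"
        using 2(1) by auto
      show ?thesis
      proof (cases "{b, c, d, e} \<in> B")
        case True
        have "listed L {{a, b, c}, {a, d, e}, {b, c, d, e}}"
          using listed_c[OF 2(1)] 2(2) by simp
        moreover have "{{a, b, c}, {a, d, e}, {b, c, d, e}} \<subseteq> B"
          using XY 2(3,4) True by simp
        ultimately show ?thesis
          by blast
      next
        case False
        consider "{{a, b, c, d}, {a, b, c, e}, {a, b, d, e}, {a, c, d, e}} \<subseteq> B"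
          | "{a, c, d, e} \<notin> B" | "{a, b, d, e} \<notin> B" | "{a, b, c, e} \<notin> B" | "{a, b, c, d} \<notin> B"
          by blast
        then show ?thesis
        proof cases
          case i: 1
          have "listed L {{a, b, c}, {a, d, e}, {a, b, c, d}, {a, b, c, e}, {a, b, d, e}, {a, c, d, e}}"
            using listed_d[OF 2(1)] 2(2) by simp
          moreover have "{{a, b, c}, {a, d, e}, {a, b, c, d}, {a, b, c, e}, {a, b, d, e}, {a, c, d, e}} \<subseteq> B"
            using XY 2(3,4) i by simp
          ultimately show ?thesis
            by blast
        next
          case i: 2
          have "non_FC B"
            by (rule non_FC_Diff[OF non_FC_two_triples_meeting_in_one[OF perms(1)] sub,
                  where Q = "{{a, c, d, e}, {b, c, d, e}}"])
              (use i False in \<open>simp_all add: certificate_simps insert_Diff_if distinct_five_neqs[OF 2(1)]\<close>)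
          then show ?thesis ..
        next
          case i: 3
          have "non_FC B"
            by (rule non_FC_Diff[OF non_FC_two_triples_meeting_in_one[OF perms(2)] sub,
                  where Q = "{{a, b, d, e}, {b, c, d, e}}"])
              (use i False in \<open>simp_all add: certificate_simps insert_Diff_if distinct_five_neqs[OF 2(1)]\<close>)
          then show ?thesis ..
        next
          case i: 4
          have "non_FC B"
            by (rule non_FC_Diff[OF non_FC_two_triples_meeting_in_one[OF perms(3)] sub,
                  where Q = "{{a, b, c, e}, {b, c, d, e}}"])
              (use i False in \<open>simp_all add: certificate_simps insert_Diff_if distinct_five_neqs[OF 2(1)]\<close>)
          then show ?thesis ..
        next
          case i: 5
          have "non_FC B"
            by (rule non_FC_Diff[OF non_FC_two_triples_meeting_in_one[OF perms(4)] sub,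
                  where Q = "{{a, b, c, d}, {b, c, d, e}}"])
              (use i False in \<open>simp_all add: certificate_simps insert_Diff_if distinct_five_neqs[OF 2(1)]\<close>)
          then show ?thesis ..
        qed
      qed
    qed
  next
    case 3
    then obtain X where T: "T = {X}"
      by (auto simp: card_1_singleton_iff)
    then have X: "X \<in> B" "X \<in> nsets L 3"
      unfolding T_def by blast+
    obtain a b c where abc: "X = {a, b, c}" "a \<noteq> b" "a \<noteq> c" "b \<noteq> c"
      using X(2) by (auto simp: nsets_def card_3_iff)
    have "card (L - X) = 2"
      using X(2) L by (subst card_Diff_subset) (auto simp: nsets_def)
    then obtain d e where de: "L - X = {d, e}" "d \<noteq> e"
      by (auto simp: card_2_iff)
    have five: "distinct [a, b, c, d, e]" "L = {a, b, c, d, e}"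
      using abc de X(2) by (auto simp: nsets_def)
    have sub: "B \<subseteq> {{}, {a, b, c, d, e}} \<union> {{a, b, c}} \<union>
        {{a, b, c, d}, {a, b, c, e}, {a, b, d, e}, {a, c, d, e}, {b, c, d, e}}"
      using B_sub unfolding T abc(1) five(2) nsets_4_of_five[OF five(1)] .
    \<comment> \<open>The first entry is the point omitted by the missing 4-set; it is then common
      to all nonempty members of \<open>B\<close>.\<close>
    have perms: "distinct [a, b, c, d, e]" "distinct [b, a, c, d, e]" "distinct [c, a, b, d, e]"
      using five(1) by auto
    consider "{{a, b, d, e}, {a, c, d, e}, {b, c, d, e}} \<subseteq> B"
      | "{b, c, d, e} \<notin> B" | "{a, c, d, e} \<notin> B" | "{a, b, d, e} \<notin> B"
      by blast
    then show ?thesis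
    proof cases
      case i: 1
      have "listed L {{a, b, c}, {a, b, d, e}, {a, c, d, e}, {b, c, d, e}}"
        using listed_e[OF five(1)] five(2) by simp
      moreover have "{{a, b, c}, {a, b, d, e}, {a, c, d, e}, {b, c, d, e}} \<subseteq> B"
        using X(1) abc(1) i by simp
      ultimately show ?thesis
        by blast
    next
      case i: 2
      have "non_FC B"
        by (rule non_FC_Diff[OF non_FC_one_triple[OF perms(1)] sub,
              where Q = "{{b, c, d, e}}"])
          (use i in \<open>simp_all add: certificate_simps insert_Diff_if distinct_five_neqs[OF five(1)]\<close>)
      then show ?thesis ..
    next
      case i: 3
      have "non_FC B"
        by (rule non_FC_Diff[OF non_FC_one_triple[OF perms(2)] sub,
              where Q = "{{a, c, d, e}}"])
          (use i in \<open>simp_all add: certificate_simps insert_Diff_if distinct_five_neqs[OF five(1)]\<close>)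
      then show ?thesis ..
    next
      case i: 4
      have "non_FC B"
        by (rule non_FC_Diff[OF non_FC_one_triple[OF perms(3)] sub,
              where Q = "{{a, b, d, e}}"])
          (use i in \<open>simp_all add: certificate_simps insert_Diff_if distinct_five_neqs[OF five(1)]\<close>)
      then show ?thesis ..
    qed
  next
    case 4
    then have T: "T = {}"
      using finT by simp
    show ?thesis
    proof (cases "nsets L 4 \<subseteq> B")
      case True
      then show ?thesis
        unfolding listed_def by blast
    next
      case False
      then obtain X where X: "X \<in> nsets L 4" "X \<notin> B"
        by blast
      then have "card (L - X) = 1"
        using L by (subst card_Diff_subset) (auto simp: nsets_def)
      \<comment> \<open>The point omitted by the missing 4-set becomes the common point.\<close>
      then obtain a where a: "L - X = {a}"
        by (auto simp: card_1_singleton_iff)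
      obtain xs where xs: "distinct xs" "set xs = X"
        using X(1) finite_distinct_list[of X] by (auto simp: nsets_def)
      with X(1) have "length xs = 4"
        by (metis (mono_tags, lifting) distinct_card mem_Collect_eq nsets_def)
      then obtain b c d e where bcde: "xs = [b, c, d, e]"
        by (auto simp: numeral_eq_Suc length_Suc_conv)
      have five: "distinct [a, b, c, d, e]" "L = {a, b, c, d, e}"
        using xs bcde a X(1) by (auto simp: nsets_def)
      have "X = {b, c, d, e}"
        using xs bcde by simp
      then have i: "{b, c, d, e} \<notin> B"
        using X(2) by simp
      have sub: "B \<subseteq> {{}, {a, b, c, d, e}} \<union> {} \<union>
          {{a, b, c, d}, {a, b, c, e}, {a, b, d, e}, {a, c, d, e}, {b, c, d, e}}"
        using B_sub unfolding T five(2) nsets_4_of_five[OF five(1)] .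
      have "non_FC B"
        by (rule non_FC_Diff[OF non_FC_one_triple[OF five(1)] sub, where Q = "{{b, c, d, e}}"])
          (use i in \<open>simp_all add: certificate_simps insert_Diff_if distinct_five_neqs[OF five(1)]\<close>)
      then show ?thesis ..
    qed
  qed
qed

section \<open>Listed systems and permutations of \<open>{1..5}\<close>\<close>

lemma permutes_five:
  assumes "distinct [a, b, c, d, e]" "{1..5} = {a, b, c, d, e :: nat}"
  obtains p where "p permutes {1..5}" "p 1 = a" "p 2 = b" "p 3 = c" "p 4 = d" "p 5 = e"
proof -
  define p where "p x = (if x = 1 then a else if x = 2 then b else if x = 3 then c
    else if x = 4 then d else if x = 5 then e else x)" for x
  have five: "{1..5} = {1, 2, 3, 4, 5 :: nat}"
    by auto
  have "inj_on p {1..5}"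
    unfolding five using distinct_five_neqs[OF assms(1)] by (simp add: p_def)
  moreover have "p ` {1..5} = {1..5}"
    unfolding assms(2) by (subst assms(2)[symmetric], unfold five) (auto simp: p_def)
  ultimately have "p permutes {1..5}"
    by (intro bij_imp_permutes) (auto simp: bij_betw_def p_def)
  then show thesis
    by (rule that) (simp_all add: p_def)
qed

lemma image_nsets_permutes:
  assumes "p permutes L" "S \<subseteq> nsets L k"
  shows "(`) p ` S \<subseteq> nsets L k" "card ((`) p ` S) = card S"
proof -
  have inj: "inj_on p A" for A
    using permutes_inj[OF assms(1)] by (rule inj_on_subset) simp
  have "p ` X \<in> nsets L k" if "X \<in> nsets L k" for X
    using that permutes_image[OF assms(1)] by (auto simp: nsets_def card_image[OF inj])
  then show "(`) p ` S \<subseteq> nsets L k"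
    using assms(2) by blast
  show "card ((`) p ` S) = card S"
    by (rule card_image) (meson inj_on_image_Pow inj inj_on_subset subset_Pow_Union)
qed

text \<open>Copies the disjunction of the theorem verbatim, so that it can be folded there.\<close>

definition listed_literal :: "nat set set \<Rightarrow> bool" where
  "listed_literal S \<longleftrightarrow>
     (S \<subseteq> nsets {1..5} 3 \<and> card S = 3) \<or>
     S = {{1,2,3}, {1,2,4}, {1,3,4,5}} \<or>
     S = {{1,2,3}, {1,4,5}, {2,3,4,5}} \<or>
     S = {{1,2,3}, {1,4,5}, {1,2,3,4}, {1,2,3,5}, {1,2,4,5}, {1,3,4,5}} \<or>
     S = {{1,2,3}, {1,2,4,5}, {1,3,4,5}, {2,3,4,5}} \<or>
     S = nsets {1..5} 4"

lemma finite_subset_nsets: "finite L \<Longrightarrow> S \<subseteq> nsets L k \<Longrightarrow> finite S"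
  by (meson finite_imp_finite_nsets finite_subset)

text \<open>An enumeration \<open>a\<close>, ..., \<open>e\<close> of \<open>{1..5}\<close> is the
  same as a permutation with \<open>p 1 = a\<close>, ..., \<open>p 5 = e\<close>.\<close>

lemma listed_iff_permuted:
  "listed {1..5} S \<longleftrightarrow> (\<exists>S' p. p permutes {1..5} \<and> S = (`) p ` S' \<and> listed_literal S')"
proof
  assume "\<exists>S' p. p permutes {1..5} \<and> S = (`) p ` S' \<and> listed_literal S'"
  then obtain S' p where p: "p permutes {1..5}" and S: "S = (`) p ` S'" and S': "listed_literal S'"
    by blast
  have five: "{1..5} = {1, 2, 3, 4, 5 :: nat}"
    by auto
  have img: "{1..5} = {p 1, p 2, p 3, p 4, p 5}"
    using permutes_image[OF p] unfolding five by simp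
  have dist: "distinct [p 1, p 2, p 3, p 4, p 5]"
    by (rule distinct_five_if_card) (unfold img[symmetric], simp)
  have "(`) p ` nsets {1..5} 4 = nsets {1..5} 4"
    using image_nsets_permutes[OF p subset_refl, of 4]
    by (intro card_subset_eq) (auto simp: finite_imp_finite_nsets)
  then show "listed {1..5} S"
    using S' image_nsets_permutes[OF p, of S' 3] unfolding listed_literal_def S
  proof (elim disjE conjE)
    assume "S' \<subseteq> nsets {1..5} 3" "card S' = 3"
    then show "listed {1..5} ((`) p ` S')"
      unfolding listed_def using image_nsets_permutes[OF p, of S' 3] by simp
  next
    assume "S' = nsets {1..5} 4" "(`) p ` nsets {1..5} 4 = nsets {1..5} 4"
    then show "listed {1..5} ((`) p ` S')"
      unfolding listed_def by simp
  qed (use listed_cases[OF dist] img in simp_all)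
next
  assume "listed {1..5} S"
  then show "\<exists>S' p. p permutes {1..5} \<and> S = (`) p ` S' \<and> listed_literal S'"
    unfolding listed_def
  proof (elim disjE exE conjE)
    assume "S \<subseteq> nsets {1..5} 3" "card S = 3"
    then show ?thesis
      by (intro exI[of _ S] exI[of _ id]) (simp add: listed_literal_def permutes_id)
  next
    assume "S = nsets {1..5} 4"
    then show ?thesis
      by (intro exI[of _ S] exI[of _ id]) (simp add: listed_literal_def permutes_id)
  next
    fix a b c d e :: nat
    assume five: "distinct [a, b, c, d, e]" "{1..5} = {a, b, c, d, e}"
    obtain p where p: "p permutes {1..5}" "p 1 = a" "p 2 = b" "p 3 = c" "p 4 = d" "p 5 = e"
      using permutes_five[OF five] .
    {
      assume "S = {{a, b, c}, {a, b, d}, {a, c, d, e}}"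
      then show ?thesis
        using p by (intro exI[of _ "{{1,2,3}, {1,2,4}, {1,3,4,5}}"] exI[of _ p])
          (simp add: listed_literal_def)
    next
      assume "S = {{a, b, c}, {a, d, e}, {b, c, d, e}}"
      then show ?thesis
        using p by (intro exI[of _ "{{1,2,3}, {1,4,5}, {2,3,4,5}}"] exI[of _ p])
          (simp add: listed_literal_def)
    next
      assume "S = {{a, b, c}, {a, d, e}, {a, b, c, d}, {a, b, c, e}, {a, b, d, e}, {a, c, d, e}}"
      then show ?thesis
        using p by (intro exI[of _ "{{1,2,3}, {1,4,5}, {1,2,3,4}, {1,2,3,5}, {1,2,4,5}, {1,3,4,5}}"]
            exI[of _ p]) (simp add: listed_literal_def)
    next
      assume "S = {{a, b, c}, {a, b, d, e}, {a, c, d, e}, {b, c, d, e}}"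
      then show ?thesis
        using p by (intro exI[of _ "{{1,2,3}, {1,2,4,5}, {1,3,4,5}, {2,3,4,5}}"] exI[of _ p])
          (simp add: listed_literal_def)
    }
  qed
qed

lemma finite_listed_literal: "listed_literal S \<Longrightarrow> finite S"
  unfolding listed_literal_def
  by (elim disjE conjE) (simp_all add: finite_subset_nsets[OF finite_atLeastAtMost] finite_imp_finite_nsets)

section \<open>The classification\<close>

text \<open>Together with \<open>FC_doubleton\<close> this excludes 1-sets and 2-sets from a proper
  \<open>FC(5)\<close>-family, since each generates a smaller FC-family.\<close>

lemma FC_singleton: "FC 1 {{}, {x}}"
proof -
  have "FC (card {x}) {{}, {x}}"
    by (rule FC_certificate[where c = "\<lambda>_. 1" and cs = "[(1, {}, {}, {x})]"])
      (simp_all add: certificate_simps)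
  then show ?thesis
    by simp
qed

lemma FC_doubleton:
  assumes "x \<noteq> y"
  shows "FC 2 {{}, {x, y}}"
proof -
  have "FC (card {x, y}) {{}, {x, y}}"
    by (rule FC_certificate[where c = "\<lambda>_. 1" and cs = "[(2, {}, {}, {x, y})]"])
      (use assms in \<open>simp_all add: certificate_simps ex_disj_distrib\<close>)
  then show ?thesis
    using assms by (simp add: numeral_2_eq_2)
qed

text \<open>A proper \<open>B\<close> has no 1-sets or 2-sets and is not \<open>non_FC\<close>, so
  it contains a listed \<open>S\<close>; the family generated by \<open>S\<close> is an FC-family
  inside \<open>B\<close>, hence equal to it. Conversely, \<open>L \<in> B\<close> activates the
  properness clause of \<open>critical\<close>.\<close>

lemma proper_FC_5_iff:
  assumes L: "card L = 5" "L \<in> B" "B \<subseteq> Pow L"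
  shows "proper_FC 5 B \<longleftrightarrow> (\<exists>S. listed L S \<and> B = generated_family S)"
proof
  assume proper: "proper_FC 5 B"
  then have FC: "FC 5 B" and min: "\<And>C. C \<subseteq> B \<Longrightarrow> FC_family C \<Longrightarrow> C = B"
    unfolding proper_FC_def by blast+
  from FC have B: "FC_family B" "union_closed B" "{} \<in> B"
    unfolding FC_family_def by (blast, simp_all add: FC_def)
  have "card X \<noteq> 1 \<and> card X \<noteq> 2" if X: "X \<in> B" for X
  proof -
    have "\<not> FC_family {{}, X}" if "card X < 5"
    proof
      assume "FC_family {{}, X}"
      then have "{{}, X} = B"
        using min[of "{{}, X}"] X B(3) by simp
      then have "L \<in> {{}, X}"
        using L(2) by simp
      then show False
        using L(1) that by auto
    qed
    moreover have "FC_family {{}, X}" if one: "card X = 1"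
    proof -
      obtain x where "X = {x}"
        using one by (auto simp: card_1_singleton_iff)
      then show ?thesis
        using FC_singleton[of x] unfolding FC_family_def by blast
    qed
    moreover have "FC_family {{}, X}" if two: "card X = 2"
    proof -
      obtain x y where "X = {x, y}" "x \<noteq> y"
        using two by (auto simp: card_2_iff)
      then show ?thesis
        using FC_doubleton[of x y] unfolding FC_family_def by blast
    qed
    ultimately show ?thesis
      by fastforce
  qed
  then have "non_FC B \<or> (\<exists>S\<subseteq>B. listed L S)"
    using non_FC_or_listed[OF L(1,3)] by blast
  then obtain S where S: "S \<subseteq> B" "listed L S"
    using B(1) unfolding non_FC_def by blast
  then have "generated_family S = B"
    using min[OF generated_family_least[OF S(1) B(3,2)]] critical_if_listed[OF L(1) S(2)]
    by (simp add: critical_def)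
  then show "\<exists>S. listed L S \<and> B = generated_family S"
    using S(2) by blast
next
  assume "\<exists>S. listed L S \<and> B = generated_family S"
  then show "proper_FC 5 B"
    using critical_if_listed[OF L(1)] L(2) by (auto simp: critical_def)
qed

section \<open>FC numbers\<close>

text \<open>For every \<open>j < m\<close>, some \<open>j\<close>-subset of \<open>T\<close>
  generates a subfamily of \<open>M\<close>, which refutes \<open>j\<close>; at least
  \<open>m - 1\<close> members in \<open>T\<close> suffice for this.\<close>

lemma FC_number_eqI:
  assumes "\<And>S. S \<subseteq> nsets {1..n} k \<Longrightarrow> card S = m \<Longrightarrow> FC_family (generated_family S)"
    and T: "T \<subseteq> nsets {1..n} k" "m \<le> Suc (card T)"
    and M: "T \<subseteq> M" "{} \<in> M" "union_closed M" "non_FC M"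
  shows "FC_number k n = m"
  unfolding FC_number_def
proof (rule Least_equality)
  show "\<forall>S. S \<subseteq> nsets {1..n} k \<and> card S = m \<longrightarrow> FC_family (generated_family S)"
    using assms(1) by blast
next
  fix j
  assume j: "\<forall>S. S \<subseteq> nsets {1..n} k \<and> card S = j \<longrightarrow> FC_family (generated_family S)"
  show "m \<le> j"
  proof (rule ccontr)
    assume "\<not> m \<le> j"
    then have "j \<le> card T"
      using T(2) by linarith
    then obtain S where "S \<subseteq> T" "card S = j"
      by (meson obtain_subset_with_card_n)
    then show False
      using j T(1) M generated_family_least[of S M] unfolding non_FC_def by blast
  qed
qed

theorem theorem1:
  shows "(\<forall>B :: nat set set.
            B \<subseteq> Pow {1..5} \<and> (\<exists>L. largest_set B L \<and> card L = 5) \<longrightarrow>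
            (proper_FC 5 B \<longleftrightarrow>
              (\<exists>S p. p permutes {1..5} \<and> B = (`) p ` generated_family S \<and>
                ((S \<subseteq> nsets {1..5} 3 \<and> card S = 3) \<or>
                 S = {{1,2,3}, {1,2,4}, {1,3,4,5}} \<or>
                 S = {{1,2,3}, {1,4,5}, {2,3,4,5}} \<or>
                 S = {{1,2,3}, {1,4,5}, {1,2,3,4}, {1,2,3,5}, {1,2,4,5}, {1,3,4,5}} \<or>
                 S = {{1,2,3}, {1,2,4,5}, {1,3,4,5}, {2,3,4,5}} \<or>
                 S = nsets {1..5} 4))))
         \<and> FC_number 3 5 = 3 \<and> FC_number 4 5 = 5"
  unfolding listed_literal_def[symmetric]
proof (intro conjI allI impI)
  fix B :: "nat set set"
  assume "B \<subseteq> Pow {1..5} \<and> (\<exists>L. largest_set B L \<and> card L = 5)"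
  then obtain L where B: "B \<subseteq> Pow {1..5}" and L: "L \<in> B" "card L = 5"
    by (auto simp: largest_set_def is_arg_max_def)
  then have "L = {1..5}"
    by (intro card_subset_eq) auto
  then have "proper_FC 5 B \<longleftrightarrow> (\<exists>S. listed {1..5} S \<and> B = generated_family S)"
    using B L by (intro proper_FC_5_iff) simp_all
  \<comment> \<open>Permuting a system and permuting the family it generates amount to the
    same.\<close>
  also have "\<dots> \<longleftrightarrow> (\<exists>S p. p permutes {1..5} \<and> B = (`) p ` generated_family S \<and> listed_literal S)"
    unfolding listed_iff_permuted by (metis image_generated_family finite_listed_literal)
  finally show "proper_FC 5 B \<longleftrightarrow>
    (\<exists>S p. p permutes {1..5} \<and> B = (`) p ` generated_family S \<and> listed_literal S)" .
next
  have dist: "distinct [1, 2, 3, 4, 5 :: nat]" and five: "{1..5} = {1, 2, 3, 4, 5 :: nat}"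
    by auto
  note simps = certificate_simps distinct_five_neqs[OF dist]
  show "FC_number 3 5 = 3"
  proof (rule FC_number_eqI)
    show "FC_family (generated_family S)" if "S \<subseteq> nsets {1..5} 3" "card S = 3" for S
      using critical_three_triples[OF _ that] by (simp add: critical_def)
    show "{{1, 2, 3}, {1, 2, 4 :: nat}} \<subseteq> nsets {1..5} 3"
      unfolding five nsets_3_of_five[OF dist] by simp
    show "3 \<le> Suc (card {{1, 2, 3}, {1, 2, 4 :: nat}})"
      by (simp add: simps)
    show "non_FC {{}, {1, 2, 3}, {1, 2, 4}, {1, 2, 3, 4}, {1, 2, 3, 5}, {1, 2, 4, 5}, {1, 2, 3, 4, 5}}"
      by (rule non_FC_two_triples_meeting_in_two[OF dist])
  qed (simp_all add: simps)
  show "FC_number 4 5 = 5"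
  proof (rule FC_number_eqI)
    show "FC_family (generated_family S)" if "S \<subseteq> nsets {1..5} 4" "card S = 5" for S
    proof -
      have "S = nsets {1..5} 4"
        using that by (intro card_subset_eq) (simp_all add: finite_imp_finite_nsets card_nsets numeral_eq_Suc)
      then show ?thesis
        using critical_if_listed[of "{1..5}" S] by (simp add: critical_def listed_def)
    qed
    \<comment> \<open>The four 4-sets through 1 lie in a maximal non-FC family.\<close>
    show "{{1, 2, 3, 4}, {1, 2, 3, 5}, {1, 2, 4, 5}, {1, 3, 4, 5 :: nat}} \<subseteq> nsets {1..5} 4"
      unfolding five nsets_4_of_five[OF dist] by simp
    show "5 \<le> Suc (card {{1, 2, 3, 4}, {1, 2, 3, 5}, {1, 2, 4, 5}, {1, 3, 4, 5 :: nat}})"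
      by (simp add: simps)
    show "non_FC {{}, {1, 2, 3}, {1, 2, 3, 4}, {1, 2, 3, 5}, {1, 2, 4, 5}, {1, 3, 4, 5}, {1, 2, 3, 4, 5}}"
      by (rule non_FC_one_triple[OF dist])
  qed (simp_all add: simps)
qed

end
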